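(* There exist two families of Boolean functions $(f_n(\mathbf{X}_n))_{n\ge 1}$ and $(g_n(\mathbf{X}_n,Z))_{n \ge 1}$, where $Z$ is a single variable not in $\mathbf{X}_n$, such that: (i) for every $n$, $f_n$ is equivalent modulo forgetting to $g_n$, i.e. $f_n(\mathbf{X}_n) \equiv \exists Z.\, g_n(\mathbf{X}_n,Z)$; (ii) every d-DNNF computing $f_n$ has size at least exponential in $n$; and (iii) for every $n$ there is a d-DNNF computing $g_n$ whose size is polynomial in $n$.
   Context: An NNF (negation normal form) is a rooted directed acyclic graph whose internal nodes are labeled with $\wedge$ or $\vee$ and whose leaves are labeled with literals or the constants $\top,\bot$; its size is its number of nodes/edges. A conjunction node is decomposable if each pair of its children share no variables; a disjunction node is deterministic if each pair of its children are logically inconsistent. A DNNF is an NNF whose conjunctions are all decomposable; a d-DNNF is a DNNF whose disjunctions are all deterministic. For a Boolean function $g$ and variable $Z$, $\exists Z.\, g = g|Z \vee g|\neg Z$, where $g|\ell$ denotes conditioning on literal $\ell$. *)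

theory Defs
  imports Complex_Main
begin

text \<open>NNF circuits over variables of type nat. A DAG is represented by a term;
 shared nodes are identified with syntactically equal subterms (maximal sharing),
 so the DAG nodes are the distinct subterms.\<close>

datatype nnf = Lit nat bool | Top | Bot | And "nnf list" | Or "nnf list"

fun eval :: "nnf \<Rightarrow> (nat \<Rightarrow> bool) \<Rightarrow> bool" where
  "eval (Lit v b) \<sigma> = (\<sigma> v = b)"
| "eval Top \<sigma> = True"
| "eval Bot \<sigma> = False"
| "eval (And cs) \<sigma> = (\<forall>c\<in>set cs. eval c \<sigma>)"
| "eval (Or cs) \<sigma> = (\<exists>c\<in>set cs. eval c \<sigma>)"

fun vars :: "nnf \<Rightarrow> nat set" where
  "vars (Lit v b) = {v}"
| "vars Top = {}"
| "vars Bot = {}"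
| "vars (And cs) = (\<Union>c\<in>set cs. vars c)"
| "vars (Or cs) = (\<Union>c\<in>set cs. vars c)"

fun children :: "nnf \<Rightarrow> nnf list" where
  "children (And cs) = cs"
| "children (Or cs) = cs"
| "children _ = []"

fun nodes :: "nnf \<Rightarrow> nnf set" where
  "nodes (And cs) = insert (And cs) (\<Union>c\<in>set cs. nodes c)"
| "nodes (Or cs) = insert (Or cs) (\<Union>c\<in>set cs. nodes c)"
| "nodes c = {c}"

definition size_nnf :: "nnf \<Rightarrow> nat" where
  "size_nnf C = (\<Sum>s\<in>nodes C. 1 + length (children s))"

definition decomposable :: "nnf list \<Rightarrow> bool" where
  "decomposable cs = (\<forall>i<length cs. \<forall>j<length cs. i \<noteq> j \<longrightarrow> vars (cs!i) \<inter> vars (cs!j) = {})"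

definition deterministic :: "nnf list \<Rightarrow> bool" where
  "deterministic cs = (\<forall>i<length cs. \<forall>j<length cs. i \<noteq> j \<longrightarrow> \<not> (\<exists>\<sigma>. eval (cs!i) \<sigma> \<and> eval (cs!j) \<sigma>))"

definition is_dDNNF :: "nnf \<Rightarrow> bool" where
  "is_dDNNF C = (\<forall>s\<in>nodes C. (\<forall>cs. s = And cs \<longrightarrow> decomposable cs) \<and>
                               (\<forall>cs. s = Or cs \<longrightarrow> deterministic cs))"

definition depends_only :: "((nat \<Rightarrow> bool) \<Rightarrow> bool) \<Rightarrow> nat set \<Rightarrow> bool" where
  "depends_only f V = (\<forall>\<sigma> \<sigma>'. (\<forall>v\<in>V. \<sigma> v = \<sigma>' v) \<longrightarrow> f \<sigma> = f \<sigma>')"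

definition forget :: "nat \<Rightarrow> ((nat \<Rightarrow> bool) \<Rightarrow> bool) \<Rightarrow> (nat \<Rightarrow> bool) \<Rightarrow> bool" where
  "forget z g = (\<lambda>\<sigma>. g (\<sigma>(z := True)) \<or> g (\<sigma>(z := False)))"

end

theory Submission
  imports Defs "HOL-Analysis.Convex" "HOL-Combinatorics.Permutations"
begin

text \<open>Let \<open>p\<close> and \<open>q\<close> be the parities of the number of edges of two paths inside the set of true
  variables. Each is computed by a small d-DNNF, which reads the variables along its path, and
  \<open>g\<close> uses \<open>Z\<close> to choose between \<open>p = a\<close> and \<open>q = b\<close>; forgetting \<open>Z\<close> gives their disjunction \<open>f\<close>.

  A d-DNNF of size \<open>s\<close> partitions its models into at most \<open>s\<^sup>2\<close> balanced combinatorial rectangles.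
  The union of the two paths is chosen, by counting permutations, to be an expander. Then the sign
  \<open>(-1)\<close> to the power \<open>p + q\<close>, a quadratic form whose matrix has linear rank across every balanced cut,
  has exponentially small discrepancy on each such rectangle, and hence on the models of a small
  d-DNNF. But the sign is constant on the countermodels of \<open>f\<close>, which for suitable \<open>a\<close> and \<open>b\<close>
  are at least a quarter of all assignments, so on the models of \<open>f\<close> its sum is large.\<close>

section \<open>Balanced sets and rectangles\<close>

text \<open>\<open>E\<close> is a reference set inside the full vertex set, in the application the
  even vertices; how \<open>S\<close> meets the other vertices is left free.\<close>

definition balanced :: "'a set \<Rightarrow> 'a set \<Rightarrow> bool" where
  "balanced E S \<longleftrightarrow> card E \<le> 3 * card (S \<inter> E) \<and> 3 * card (S \<inter> E) \<le> 2 * card E"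

text \<open>Closure under exchange makes \<open>R\<close> a product of a family on \<open>S\<close>
  and a family on \<open>V - S\<close>, without naming the two factors.\<close>

definition rectangle :: "'a set \<Rightarrow> 'a set \<Rightarrow> 'a set set \<Rightarrow> bool" where
  "rectangle V S R \<longleftrightarrow> R \<subseteq> Pow V \<and> (\<forall>x\<in>R. \<forall>y\<in>R. (x \<inter> S) \<union> (y - S) \<in> R)"

lemma balanced_between:
  assumes "finite E" "2 \<le> card E" "A \<subseteq> B"
    and "3 * card (A \<inter> E) \<le> 2 * card E" "card E \<le> 3 * card (B \<inter> E)"
  shows "\<exists>S. A \<subseteq> S \<and> S \<subseteq> B \<and> balanced E S"
proof (cases "card E \<le> 3 * card (A \<inter> E)")
  case True
  then show ?thesis using assms unfolding balanced_def by blast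
next
  case False
  \<comment> \<open>A third of \<open>card E\<close>, rounded up; it stays within two thirds because
    \<open>card E\<close> is at least 2.\<close>
  define q where "q = (card E + 2) div 3"
  have q: "card E \<le> 3 * q" "3 * q \<le> 2 * card E" "card (A \<inter> E) \<le> q" "q \<le> card (B \<inter> E)"
    using assms False unfolding q_def by linarith+
  obtain T where T: "A \<inter> E \<subseteq> T" "T \<subseteq> B \<inter> E" "card T = q"
    using exists_subset_between[of "A \<inter> E" q "B \<inter> E"] q assms by blast
  have "(A \<union> T) \<inter> E = T" using T by blast
  then have "balanced E (A \<union> T)" using T q unfolding balanced_def by simp
  then show ?thesis using T assms(3) by (intro exI[of _ "A \<union> T"]) blast
qed

text \<open>A minimal subfamily covering a third of \<open>E\<close> works unless it covers more
  than two thirds. In that case removing a member leaves less than a third, so this member covers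
  more than a third and is balanced alone.\<close>

lemma balanced_subfamily:
  fixes A :: "'i \<Rightarrow> 'a set"
  assumes "finite E" "finite I"
    and small: "\<And>i. i \<in> I \<Longrightarrow> 3 * card (A i \<inter> E) \<le> 2 * card E"
    and big: "card E \<le> 3 * card ((\<Union>i\<in>I. A i) \<inter> E)"
  shows "\<exists>J\<subseteq>I. balanced E (\<Union>i\<in>J. A i)"
proof -
  define P where "P J \<longleftrightarrow> J \<subseteq> I \<and> card E \<le> 3 * card ((\<Union>i\<in>J. A i) \<inter> E)" for J
  have "P I" using big by (simp add: P_def)
  then obtain J where J: "P J" and min: "\<And>J'. P J' \<Longrightarrow> card J \<le> card J'"
    using ex_has_least_nat[of P I card] by blast
  show ?thesis
  proof (cases "3 * card ((\<Union>i\<in>J. A i) \<inter> E) \<le> 2 * card E")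
    case True
    then show ?thesis using J unfolding P_def balanced_def by blast
  next
    case False
    then obtain i where i: "i \<in> J" by fastforce
    have "finite J" using J assms(2) finite_subset unfolding P_def by blast
    then have "card (J - {i}) < card J" using i by (meson card_Diff1_less)
    then have "\<not> P (J - {i})" using min by fastforce
    then have lt: "3 * card ((\<Union>j\<in>J-{i}. A j) \<inter> E) < card E"
      using J unfolding P_def by auto
    have "(\<Union>j\<in>J. A j) \<inter> E = ((\<Union>j\<in>J-{i}. A j) \<inter> E) \<union> (A i \<inter> E)" using i by blast
    then have "card ((\<Union>j\<in>J. A j) \<inter> E) \<le> card ((\<Union>j\<in>J-{i}. A j) \<inter> E) + card (A i \<inter> E)"
      by (simp add: card_Un_le)
    then have "card E \<le> 3 * card (A i \<inter> E)" using lt False by linarith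
    moreover have "i \<in> I" using i J by (auto simp: P_def)
    ultimately have "balanced E (\<Union>j\<in>{i}. A j)" "{i} \<subseteq> I" using small by (auto simp: balanced_def)
    then show ?thesis by blast
  qed
qed

section \<open>Partitioning the models of a d-DNNF into balanced rectangles\<close>

lemma eval_cong: "(\<And>v. v \<in> vars C \<Longrightarrow> \<sigma> v = \<tau> v) \<Longrightarrow> eval C \<sigma> = eval C \<tau>"
proof (induction C)
  case (And cs) then show ?case by (simp, metis)
next
  case (Or cs) then show ?case by (simp, metis)
qed auto

lemma nodes_refl [simp]: "C \<in> nodes C"
  by (cases C) auto

lemma nodes_child: "c \<in> set (children C) \<Longrightarrow> nodes c \<subseteq> nodes C"
  by (cases C) auto

lemma finite_nodes [simp]: "finite (nodes C)"
  by (induction C) auto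

lemma card_nodes_le: "card (nodes C) \<le> size_nnf C"
  unfolding size_nnf_def card_eq_sum by (rule sum_mono) simp

lemma is_dDNNF_child: "is_dDNNF C \<Longrightarrow> c \<in> set (children C) \<Longrightarrow> is_dDNNF c"
  unfolding is_dDNNF_def using nodes_child by blast

lemma decomposable_children:
  assumes "is_dDNNF (And cs)" "c \<in> set cs" "d \<in> set cs" "c \<noteq> d"
  shows "vars c \<inter> vars d = {}"
proof -
  have "decomposable cs" using assms(1) unfolding is_dDNNF_def by auto
  then show ?thesis using assms(2-) unfolding decomposable_def in_set_conv_nth by metis
qed

lemma deterministic_children:
  assumes "is_dDNNF (Or cs)" "c \<in> set cs" "d \<in> set cs" "eval c \<sigma>" "eval d \<sigma>"
  shows "c = d"
proof -
  have "deterministic cs" using assms(1) unfolding is_dDNNF_def by auto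
  then show ?thesis using assms(2-) unfolding deterministic_def in_set_conv_nth by metis
qed

text \<open>Walking down from the root of \<open>C\<close> through satisfied heavy children ends at some \<open>u\<close>;
  \<open>stop h C \<sigma> (u, c)\<close> records \<open>u\<close> together with the light child \<open>c\<close> satisfied there if \<open>u\<close> is a
  disjunction, and \<open>c = u\<close> if \<open>u\<close> is a conjunction. These pairs label the rectangles.\<close>

inductive stop :: "(nnf \<Rightarrow> bool) \<Rightarrow> nnf \<Rightarrow> (nat \<Rightarrow> bool) \<Rightarrow> nnf \<times> nnf \<Rightarrow> bool" for h where
  stop_And: "h (And cs) \<Longrightarrow> \<forall>d\<in>set cs. \<not> h d \<Longrightarrow> eval (And cs) \<sigma> \<Longrightarrow> stop h (And cs) \<sigma> (And cs, And cs)"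
| stop_Or: "h (Or cs) \<Longrightarrow> c \<in> set cs \<Longrightarrow> \<not> h c \<Longrightarrow> eval c \<sigma> \<Longrightarrow> stop h (Or cs) \<sigma> (Or cs, c)"
| step_And: "c \<in> set cs \<Longrightarrow> h c \<Longrightarrow> eval (And cs) \<sigma> \<Longrightarrow> stop h c \<sigma> l \<Longrightarrow> stop h (And cs) \<sigma> l"
| step_Or: "c \<in> set cs \<Longrightarrow> h c \<Longrightarrow> stop h c \<sigma> l \<Longrightarrow> stop h (Or cs) \<sigma> l"

inductive_cases stop_AndE: "stop h (And cs) \<sigma> l"
inductive_cases stop_OrE: "stop h (Or cs) \<sigma> l"

lemma stop_eval: "stop h C \<sigma> l \<Longrightarrow> eval C \<sigma>"
  by (induction rule: stop.induct) auto

lemma stop_eval_snd: "stop h C \<sigma> l \<Longrightarrow> eval (snd l) \<sigma>"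
  by (induction rule: stop.induct) auto

lemma stop_nodes: "stop h C \<sigma> l \<Longrightarrow> l \<in> nodes C \<times> nodes C"
  by (induction rule: stop.induct) (auto, (use nodes_refl in blast)+)

lemma stop_vars: "stop h C \<sigma> l \<Longrightarrow> vars (fst l) \<subseteq> vars C"
  by (induction rule: stop.induct) auto

text \<open>Leaves are light, so a walk that starts at a heavy node can only end at a conjunction or
  a disjunction.\<close>

lemma stop_exists:
  assumes "\<And>v b. \<not> h (Lit v b)" "\<not> h Top" "\<not> h Bot"
  shows "h C \<Longrightarrow> eval C \<sigma> \<Longrightarrow> \<exists>l. stop h C \<sigma> l"
proof (induction C)
  case (And cs)
  show ?case
  proof (cases "\<forall>d\<in>set cs. \<not> h d")
    case True
    then show ?thesis using stop_And And by blast
  next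
    case False
    then obtain d where d: "d \<in> set cs" "h d" by blast
    then obtain l where "stop h d \<sigma> l" using And by fastforce
    then show ?thesis using step_And d And.prems by blast
  qed
next
  case (Or cs)
  then obtain c where c: "c \<in> set cs" "eval c \<sigma>" by auto
  show ?case
  proof (cases "h c")
    case True
    then obtain l where "stop h c \<sigma> l" using Or c by blast
    then show ?thesis using step_Or c True by blast
  next
    case False
    then show ?thesis using stop_Or c Or.prems by blast
  qed
qed (use assms in auto)

locale heavy =
  fixes h :: "nnf \<Rightarrow> bool"
  assumes heavy_intersect: "h c \<Longrightarrow> h d \<Longrightarrow> vars c \<inter> vars d \<noteq> {}"
begin

text \<open>The walk never has a choice: at a conjunction, decomposability and
  \<open>heavy_intersect\<close> leave at most one heavy child; at a disjunction, determinism leaves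
  one satisfied child. This makes the rectangles disjoint.\<close>

lemma stop_unique: "stop h C \<sigma> l \<Longrightarrow> is_dDNNF C \<Longrightarrow> stop h C \<sigma> l' \<Longrightarrow> l = l'"
proof (induction arbitrary: l' rule: stop.induct)
  case (stop_And cs \<sigma>)
  from stop_And(5) show ?case by (rule stop_AndE) (use stop_And in auto)
next
  case (stop_Or cs c \<sigma>)
  from stop_Or(6) show ?case
  proof (rule stop_OrE)
    fix d assume "l' = (Or cs, d)" "d \<in> set cs" "eval d \<sigma>"
    then show ?thesis using deterministic_children[of cs c d \<sigma>] stop_Or by auto
  next
    fix d assume "d \<in> set cs" "h d" "stop h d \<sigma> l'"
    then show ?thesis using deterministic_children[of cs c d \<sigma>] stop_Or stop_eval by blast
  qed
next
  case (step_And c cs \<sigma> l)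
  from step_And(7) show ?case
  proof (rule stop_AndE)
    fix d assume d: "d \<in> set cs" "h d" "stop h d \<sigma> l'"
    then have "c = d" using decomposable_children[of cs c d] heavy_intersect[of c d] step_And by auto
    then show ?thesis using step_And d is_dDNNF_child[of "And cs" c] by simp
  qed (use step_And in auto)
next
  case (step_Or c cs \<sigma> l)
  from step_Or(6) show ?case
  proof (rule stop_OrE)
    fix d assume "l' = (Or cs, d)" "d \<in> set cs" "\<not> h d" "eval d \<sigma>"
    then show ?thesis using deterministic_children[of cs c d \<sigma>] step_Or stop_eval by blast
  next
    fix d assume d: "d \<in> set cs" "h d" "stop h d \<sigma> l'"
    then have "c = d" using deterministic_children[of cs c d \<sigma>] step_Or stop_eval by blast
    then show ?thesis using step_Or d is_dDNNF_child[of "Or cs" c] by simp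
  qed
qed

end

text \<open>These are the cuts on which the label \<open>l\<close> allows an exchange. Keeping
  \<open>S\<close> inside the scope of the final node hides it from all siblings met on the way
  down; at that node every relevant child is read on one side only.\<close>

definition splits :: "nat set \<Rightarrow> nnf \<times> nnf \<Rightarrow> nat set \<Rightarrow> bool" where
  "splits V l S \<longleftrightarrow> S \<subseteq> vars (fst l) \<inter> V \<and>
     (\<forall>cs. fst l = And cs \<longrightarrow> (\<forall>d\<in>set cs. vars d \<inter> V \<subseteq> S \<or> vars d \<inter> S = {})) \<and>
     (\<forall>cs. fst l = Or cs \<longrightarrow> vars (snd l) \<inter> V \<subseteq> S)"

text \<open>How the walk reaches \<open>u\<close> does not depend on the variables of \<open>u\<close>, by decomposability; so the
  assignment that satisfies \<open>c\<close> may be exchanged on \<open>S\<close>.\<close>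

lemma stop_mix:
  assumes "stop h C \<sigma>' l" "is_dDNNF C" "splits V l S" "eval (snd l) \<sigma>"
    and "\<And>v. v \<notin> V \<Longrightarrow> \<sigma> v = \<sigma>' v"
  shows "stop h C (\<lambda>v. if v \<in> S then \<sigma> v else \<sigma>' v) l"
  using assms
proof (induction rule: stop.induct)
  case (stop_And cs \<sigma>')
  let ?\<tau> = "\<lambda>v. if v \<in> S then \<sigma> v else \<sigma>' v"
  have "eval d ?\<tau>" if d: "d \<in> set cs" for d
  proof -
    have "vars d \<inter> V \<subseteq> S \<or> vars d \<inter> S = {}" using stop_And d unfolding splits_def by simp
    then have "eval d ?\<tau> = eval d \<sigma> \<or> eval d ?\<tau> = eval d \<sigma>'"
    proof
      assume *: "vars d \<inter> V \<subseteq> S"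
      have "eval d ?\<tau> = eval d \<sigma>" by (rule eval_cong) (use * stop_And(7) in auto)
      then show ?thesis ..
    next
      assume *: "vars d \<inter> S = {}"
      have "eval d ?\<tau> = eval d \<sigma>'" by (rule eval_cong) (use * in auto)
      then show ?thesis ..
    qed
    then show ?thesis using stop_And d by auto
  qed
  then show ?case using stop_And by (intro stop.stop_And) auto
next
  case (stop_Or cs c \<sigma>')
  let ?\<tau> = "\<lambda>v. if v \<in> S then \<sigma> v else \<sigma>' v"
  have *: "vars c \<inter> V \<subseteq> S" using stop_Or unfolding splits_def by simp
  have "eval c ?\<tau> = eval c \<sigma>" by (rule eval_cong) (use * stop_Or(8) in auto)
  then show ?case using stop_Or by (intro stop.stop_Or) auto
next
  case (step_And c cs \<sigma>' l)
  let ?\<tau> = "\<lambda>v. if v \<in> S then \<sigma> v else \<sigma>' v"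
  have c: "stop h c ?\<tau> l" using step_And is_dDNNF_child[of "And cs" c] by simp
  \<comment> \<open>Decomposability then hides \<open>S\<close> from the siblings of
    \<open>c\<close>, whose values remain those under \<open>\<sigma>'\<close>.\<close>
  have "S \<subseteq> vars c" using stop_vars[OF step_And(4)] step_And unfolding splits_def by blast
  have "eval d ?\<tau>" if d: "d \<in> set cs" for d
  proof (cases "d = c")
    case True then show ?thesis using stop_eval[OF c] by simp
  next
    case False
    then have "vars d \<inter> S = {}"
      using decomposable_children[of cs d c] step_And d \<open>S \<subseteq> vars c\<close> by blast
    then have "eval d ?\<tau> = eval d \<sigma>'" by (intro eval_cong) auto
    then show ?thesis using step_And d by auto
  qed
  then show ?case using c step_And by (intro stop.step_And) auto
next
  case (step_Or c cs \<sigma>' l)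
  then show ?case using is_dDNNF_child[of "Or cs" c] by (intro stop.step_Or[of c]) auto
qed

text \<open>The walk stops where the size of the scope drops from heavy to light. At a conjunction
  some of the light children together are balanced; at a disjunction a balanced set fits between the
  light child and its heavy parent.\<close>

lemma stop_splits:
  assumes "stop h C \<sigma> l" "is_dDNNF C" "finite E" "E \<subseteq> V" "2 \<le> card E"
    and h: "\<And>u. h u \<longleftrightarrow> 2 * card E < 3 * card (vars u \<inter> E)"
  shows "\<exists>S. splits V l S \<and> balanced E S"
  using assms
proof (induction rule: stop.induct)
  case (stop_And cs \<sigma>)
  have eq: "(vars d \<inter> V) \<inter> E = vars d \<inter> E" for d using \<open>E \<subseteq> V\<close> by blast
  have eq2: "(\<Union>d\<in>set cs. vars d \<inter> V) \<inter> E = vars (And cs) \<inter> E" using \<open>E \<subseteq> V\<close> by auto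
  obtain J where J: "J \<subseteq> set cs" "balanced E (\<Union>d\<in>J. vars d \<inter> V)"
    using balanced_subfamily[of E "set cs" "\<lambda>d. vars d \<inter> V"] stop_And(1,2,5) h
    unfolding eq eq2 by fastforce
  have "vars d \<inter> V \<subseteq> (\<Union>d\<in>J. vars d \<inter> V) \<or> vars d \<inter> (\<Union>d\<in>J. vars d \<inter> V) = {}"
    if "d \<in> set cs" for d
    using that J(1) decomposable_children[OF stop_And(4), of d] by (cases "d \<in> J") blast+
  then have "splits V (And cs, And cs) (\<Union>d\<in>J. vars d \<inter> V)"
    using J(1) unfolding splits_def by auto
  then show ?case using J by blast
next
  case (stop_Or cs c \<sigma>)
  have eq: "(vars d \<inter> V) \<inter> E = vars d \<inter> E" for d using \<open>E \<subseteq> V\<close> by blast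
  obtain S where S: "vars c \<inter> V \<subseteq> S" "S \<subseteq> vars (Or cs) \<inter> V" "balanced E S"
    using balanced_between[of E "vars c \<inter> V" "vars (Or cs) \<inter> V"] stop_Or h
    unfolding eq by fastforce
  then have "splits V (Or cs, c) S" unfolding splits_def by simp
  then show ?case using S by blast
next
  case (step_And c cs \<sigma> l)
  then show ?case using is_dDNNF_child[of "And cs" c] by simp
next
  case (step_Or c cs \<sigma> l)
  then show ?case using is_dDNNF_child[of "Or cs" c] by simp
qed

text \<open>Models are sorted by the label at which their walk stops. The labels are pairs of nodes,
  which is the source of the quadratic count.\<close>

theorem dDNNF_rectangle_partition:
  assumes d: "is_dDNNF C" and V: "finite V" "E \<subseteq> V" "2 \<le> card E"
  shows "\<exists>R. (\<Union>l\<in>nodes C \<times> nodes C. R l) = {x \<in> Pow V. eval C (\<lambda>v. v \<in> x)} \<and>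
      disjoint_family_on R (nodes C \<times> nodes C) \<and>
      (\<forall>l. \<exists>S\<subseteq>V. balanced E S \<and> rectangle V S (R l))"
proof -
  define M where "M = {x \<in> Pow V. eval C (\<lambda>v. v \<in> x)}"
  have E: "finite E" using V finite_subset by blast
  \<comment> \<open>Labels that no model reaches receive the empty rectangle, which also needs a
    balanced cut.\<close>
  have trivial: "\<exists>S\<subseteq>V. balanced E S \<and> rectangle V S {}"
  proof -
    have "V \<inter> E = E" using V by blast
    then show ?thesis
      using balanced_between[OF E V(3), of "{}" V] by (auto simp: rectangle_def)
  qed
  define h where "h u \<longleftrightarrow> 2 * card E < 3 * card (vars u \<inter> E)" for u
  show ?thesis
  proof (cases "h C")
    \<comment> \<open>If the root is light, a balanced \<open>S\<close> contains every variable of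
      \<open>V\<close> that the circuit reads, and all models form a single rectangle.\<close>
    case False
    have "(vars C \<inter> V) \<inter> E = vars C \<inter> E" "V \<inter> E = E" using V by auto
    then obtain S where S: "vars C \<inter> V \<subseteq> S" "S \<subseteq> V" "balanced E S"
      using balanced_between[OF E V(3), of "vars C \<inter> V" V] False unfolding h_def by auto
    have "x \<inter> S \<union> (y - S) \<in> M" if "x \<in> M" "y \<in> M" for x y
    proof -
      have "eval C (\<lambda>v. v \<in> x \<inter> S \<union> (y - S)) = eval C (\<lambda>v. v \<in> x)"
        by (rule eval_cong) (use that S in \<open>auto simp: M_def\<close>)
      then show ?thesis using that by (auto simp: M_def)
    qed
    then have "rectangle V S M" unfolding rectangle_def M_def by auto
    then show ?thesis using S trivial
      by (intro exI[of _ "\<lambda>l. if l = (C, C) then M else {}"])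
        (auto simp: M_def disjoint_family_on_def)
  next
    case True
    interpret heavy h
    proof
      fix c d assume hs: "h c" "h d"
      show "vars c \<inter> vars d \<noteq> {}"
      proof
        assume "vars c \<inter> vars d = {}"
        then have "card (vars c \<inter> E) + card (vars d \<inter> E) = card ((vars c \<inter> E) \<union> (vars d \<inter> E))"
          using E by (intro card_Un_disjoint[symmetric]) auto
        also have "\<dots> \<le> card E" using E by (intro card_mono) auto
        finally show False using hs unfolding h_def by linarith
      qed
    qed
    \<comment> \<open>A leaf sees at most one element of \<open>E\<close>, and
      \<open>3 < 2 * card E\<close>.\<close>
    have leaf: "\<not> h (Lit v b)" "\<not> h Top" "\<not> h Bot" for v b
    proof -
      have "card ({v} \<inter> E) \<le> card {v}" by (intro card_mono) auto
      then show "\<not> h (Lit v b)" using V unfolding h_def by simp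
    qed (auto simp: h_def)
    define R where "R l = {x \<in> Pow V. stop h C (\<lambda>v. v \<in> x) l}" for l
    have cover: "(\<Union>l\<in>nodes C \<times> nodes C. R l) = M"
    proof (intro equalityI subsetI)
      fix x assume "x \<in> (\<Union>l\<in>nodes C \<times> nodes C. R l)"
      then show "x \<in> M" using stop_eval unfolding R_def M_def by fast
    next
      fix x assume x: "x \<in> M"
      then have "eval C (\<lambda>v. v \<in> x)" unfolding M_def by simp
      from stop_exists[of h C, OF leaf True this] obtain l where l: "stop h C (\<lambda>v. v \<in> x) l" ..
      then have "x \<in> R l" "l \<in> nodes C \<times> nodes C"
        using x stop_nodes unfolding R_def M_def by blast+
      then show "x \<in> (\<Union>l\<in>nodes C \<times> nodes C. R l)" by blast
    qed
    have disj: "disjoint_family_on R (nodes C \<times> nodes C)"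
      using stop_unique[OF _ d] unfolding disjoint_family_on_def R_def by blast
    have rect: "\<exists>S\<subseteq>V. balanced E S \<and> rectangle V S (R l)" for l
    proof (cases "R l = {}")
      case False
      then obtain x0 where "stop h C (\<lambda>v. v \<in> x0) l" unfolding R_def by blast
      then obtain S where S: "splits V l S" "balanced E S"
        using stop_splits[OF _ d E V(2,3) h_def] by blast
      have "x \<inter> S \<union> (y - S) \<in> R l" if "x \<in> R l" "y \<in> R l" for x y
      proof -
        have "stop h C (\<lambda>v. if v \<in> S then v \<in> x else v \<in> y) l"
          by (rule stop_mix[OF _ d S(1)]) (use that in \<open>auto simp: R_def dest: stop_eval_snd\<close>)
        moreover have "(\<lambda>v. if v \<in> S then v \<in> x else v \<in> y) = (\<lambda>v. v \<in> x \<inter> S \<union> (y - S))" by auto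
        ultimately show ?thesis using that unfolding R_def by auto
      qed
      then have "rectangle V S (R l)" unfolding rectangle_def R_def by blast
      moreover have "S \<subseteq> V" using S(1) by (simp add: splits_def)
      ultimately show ?thesis using S(2) by blast
    qed (use trivial in simp)
    from cover disj rect show ?thesis unfolding M_def[symmetric] by (intro exI[of _ R] conjI allI)
  qed
qed

section \<open>Discrepancy of quadratic forms on rectangles\<close>

lemma sum_Pow_prod:
  fixes c :: "'a \<Rightarrow> real"
  assumes "finite S"
  shows "(\<Sum>y\<in>Pow S. \<Prod>v\<in>y. c v) = (\<Prod>v\<in>S. 1 + c v)"
  using prod_add[OF assms, of c "\<lambda>_. 1"] by (simp add: add.commute)

lemma prod_sign:
  fixes f :: "'a \<Rightarrow> real"
  assumes "\<And>x. x \<in> A \<Longrightarrow> f x = 1 \<or> f x = -1"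
  shows "(\<Prod>x\<in>A. f x) = 1 \<or> (\<Prod>x\<in>A. f x) = -1"
  using assms by (induction A rule: infinite_finite_induct) force+

text \<open>By Cauchy--Schwarz the square is bounded by a count of the pairs \<open>z, z'\<close> inducing the same
  character on \<open>S\<close>; the induced matching \<open>M\<close> forces such a \<open>z'\<close> to be determined by \<open>z\<close> and by its
  part outside the matched vertices.\<close>

lemma bilinear_discrepancy:
  fixes \<kappa> :: "'a \<Rightarrow> 'a \<Rightarrow> real" and a b :: "'a set \<Rightarrow> real"
  assumes fin: "finite S" "finite T"
    and a: "\<And>y. \<bar>a y\<bar> \<le> 1" and b: "\<And>z. \<bar>b z\<bar> \<le> 1"
    and \<kappa>: "\<And>v t. \<kappa> v t = 1 \<or> \<kappa> v t = -1"
    and M: "M \<subseteq> S \<times> T" "\<And>p q. (p, q) \<in> M \<Longrightarrow> \<kappa> p q = -1"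
    and induced: "\<And>p q p' q'. (p, q) \<in> M \<Longrightarrow> (p', q') \<in> M \<Longrightarrow> (p, q) \<noteq> (p', q') \<Longrightarrow> \<kappa> p q' = 1"
  shows "(\<Sum>y\<in>Pow S. \<Sum>z\<in>Pow T. a y * b z * (\<Prod>v\<in>y. \<Prod>t\<in>z. \<kappa> v t))\<^sup>2 * 2 ^ card M
    \<le> 4 ^ (card S + card T)"
proof -
  define c where "c z v = (\<Prod>t\<in>z. \<kappa> v t)" for z v
  define g where "g y = (\<Sum>z\<in>Pow T. b z * (\<Prod>v\<in>y. c z v))" for y
  define G where "G z z' \<longleftrightarrow> (\<forall>v\<in>S. c z v = c z' v)" for z z'
  define B where "B = snd ` M"
  have c: "c z v = 1 \<or> c z v = -1" for z v unfolding c_def using \<kappa> by (intro prod_sign) auto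
  \<comment> \<open>Two edges of \<open>M\<close> with a common second endpoint would violate
    \<open>induced\<close>, so \<open>B\<close> has as many elements as \<open>M\<close>.\<close>
  have "inj_on snd M"
  proof (rule inj_onI)
    fix e e' assume e: "e \<in> M" "e' \<in> M" "snd e = snd e'"
    show "e = e'"
    proof (rule ccontr)
      assume "e \<noteq> e'"
      then have "\<kappa> (fst e) (snd e') = 1" using induced[of "fst e" "snd e" "fst e'" "snd e'"] e(1,2) by simp
      moreover have "\<kappa> (fst e) (snd e) = -1" using M(2)[of "fst e" "snd e"] e(1) by simp
      ultimately show False using e by simp
    qed
  qed
  then have card_B: "card B = card M" unfolding B_def by (rule card_image)
  have BT: "B \<subseteq> T" using M(1) unfolding B_def by auto
  have finB: "finite B" using BT fin(2) by (rule finite_subset)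
  have cMT: "card M \<le> card T" using card_mono[OF fin(2) BT] card_B by simp
  have count: "card {z' \<in> Pow T. G z z'} \<le> 2 ^ (card T - card M)" for z
  proof -
    have "inj_on (\<lambda>z'. z' - B) {z' \<in> Pow T. G z z'}"
    proof (rule inj_onI)
      fix x y assume xy: "x \<in> {z' \<in> Pow T. G z z'}" "y \<in> {z' \<in> Pow T. G z z'}" "x - B = y - B"
      \<comment> \<open>Within \<open>B\<close>, only the partner \<open>q\<close> of
        \<open>p\<close> contributes a sign at \<open>p\<close>. Once \<open>w - B\<close> is known,
        the character at \<open>p\<close> therefore reveals whether \<open>q\<close> lies in
        \<open>w\<close>.\<close>
      have key: "c w p = c (w - B) p * (if q \<in> w then -1 else 1)" if pq: "(p, q) \<in> M" and w: "w \<subseteq> T" for w p q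
      proof -
        have fw: "finite w" using w fin finite_subset by blast
        have "c w p = (\<Prod>t\<in>w - B. \<kappa> p t) * (\<Prod>t\<in>w \<inter> B. \<kappa> p t)"
          unfolding c_def using prod.subset_diff[of "w \<inter> B" w "\<kappa> p"] fw by (simp add: Diff_Int)
        moreover have "(\<Prod>t\<in>w \<inter> B. \<kappa> p t) = (\<Prod>t\<in>w \<inter> B. if t = q then -1 else 1)"
        proof (rule prod.cong[OF refl])
          fix t assume "t \<in> w \<inter> B"
          then obtain p' where p': "(p', t) \<in> M" unfolding B_def by force
          show "\<kappa> p t = (if t = q then -1 else 1)"
            using M(2)[OF pq] induced[OF pq p'] by auto
        qed
        moreover have "(\<Prod>t\<in>w \<inter> B. if t = q then -1 else 1::real) = (if q \<in> w then -1 else 1)"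
        proof -
          have "q \<in> B" using pq unfolding B_def by force
          then show ?thesis using fw by (simp add: prod.delta)
        qed
        ultimately show ?thesis unfolding c_def by simp
      qed
      have "q \<in> x \<longleftrightarrow> q \<in> y" if q: "q \<in> B" for q
      proof -
        obtain p where pq: "(p, q) \<in> M" using q unfolding B_def by force
        have "p \<in> S" using pq M(1) by blast
        then have "c x p = c y p" using xy unfolding G_def by auto
        then show ?thesis
          using key[OF pq, of x] key[OF pq, of y] xy c[of "y - B" p] by (auto split: if_splits)
      qed
      then show "x = y" using xy(3) by blast
    qed
    then have "card {z' \<in> Pow T. G z z'} \<le> card (Pow (T - B))"
      by (rule card_inj_on_le) (use fin in auto)
    also have "\<dots> = 2 ^ (card T - card M)" using BT finB fin card_B by (simp add: card_Pow card_Diff_subset)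
    finally show ?thesis .
  qed
  \<comment> \<open>Orthogonality of characters on \<open>Pow S\<close>: distinct ones differ at
    some \<open>v\<close>, whose factor in the product vanishes.\<close>
  have inner: "(\<Sum>y\<in>Pow S. (\<Prod>v\<in>y. c z v) * (\<Prod>v\<in>y. c z' v)) = (if G z z' then 2 ^ card S else 0)" for z z'
  proof -
    have "(\<Sum>y\<in>Pow S. (\<Prod>v\<in>y. c z v) * (\<Prod>v\<in>y. c z' v)) = (\<Prod>v\<in>S. 1 + c z v * c z' v)"
      using sum_Pow_prod[OF fin(1), of "\<lambda>v. c z v * c z' v"] by (simp add: prod.distrib)
    also have "\<dots> = (if G z z' then 2 ^ card S else 0)"
    proof (cases "G z z'")
      case True
      have "(\<Prod>v\<in>S. 1 + c z v * c z' v) = (\<Prod>v\<in>S. 2)"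
      proof (rule prod.cong[OF refl])
        fix v assume "v \<in> S"
        then have "c z v = c z' v" using True by (simp add: G_def)
        then show "1 + c z v * c z' v = 2" using c[of z' v] by auto
      qed
      then show ?thesis using True by simp
    next
      case False
      then obtain v where v: "v \<in> S" "c z v \<noteq> c z' v" by (auto simp: G_def)
      then have "1 + c z v * c z' v = 0" using c[of z v] c[of z' v] by auto
      then have "(\<Prod>v\<in>S. 1 + c z v * c z' v) = 0" using v fin by (intro prod_zero) auto
      then show ?thesis using False by simp
    qed
    finally show ?thesis .
  qed
  have bb: "b z * b z' \<le> 1" for z z'
  proof -
    have "\<bar>b z * b z'\<bar> \<le> 1" unfolding abs_mult using b[of z] b[of z'] by (simp add: mult_le_one)
    then show ?thesis by simp
  qed
  have "(\<Sum>y\<in>Pow S. (g y)\<^sup>2) = (\<Sum>y\<in>Pow S. \<Sum>z\<in>Pow T. \<Sum>z'\<in>Pow T.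
      b z * b z' * ((\<Prod>v\<in>y. c z v) * (\<Prod>v\<in>y. c z' v)))"
    unfolding g_def power2_eq_square sum_product by (simp add: mult_ac)
  also have "\<dots> = (\<Sum>z\<in>Pow T. \<Sum>z'\<in>Pow T. \<Sum>y\<in>Pow S.
      b z * b z' * ((\<Prod>v\<in>y. c z v) * (\<Prod>v\<in>y. c z' v)))"
    by (subst sum.swap, rule sum.cong[OF refl], rule sum.swap)
  also have "\<dots> = (\<Sum>z\<in>Pow T. \<Sum>z'\<in>Pow T. b z * b z' * (if G z z' then 2 ^ card S else 0))"
    unfolding inner[symmetric] sum_distrib_left ..
  also have "\<dots> \<le> (\<Sum>z\<in>Pow T. \<Sum>z'\<in>Pow T. if G z z' then 2 ^ card S else 0)"
    by (intro sum_mono) (use bb in auto)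
  also have "\<dots> = (\<Sum>z\<in>Pow T. real (card {z' \<in> Pow T. G z z'}) * 2 ^ card S)"
    using fin by (simp add: sum.If_cases Int_def)
  also have "\<dots> \<le> (\<Sum>z\<in>Pow T. 2 ^ (card T - card M) * 2 ^ card S)"
    by (intro sum_mono mult_right_mono) (use count in \<open>simp_all add: numeral_power_le_of_nat_cancel_iff of_nat_le_numeral_power_cancel_iff\<close>)
  also have "\<dots> = 2 ^ card T * (2 ^ (card T - card M) * 2 ^ card S)" using fin by (simp add: card_Pow)
  finally have g2: "(\<Sum>y\<in>Pow S. (g y)\<^sup>2) \<le> 2 ^ card T * (2 ^ (card T - card M) * 2 ^ card S)" .
  have "(\<Sum>y\<in>Pow S. (a y)\<^sup>2) \<le> (\<Sum>y\<in>Pow S. 1)"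
    by (intro sum_mono) (use a in \<open>simp add: abs_square_le_1\<close>)
  then have a2: "(\<Sum>y\<in>Pow S. (a y)\<^sup>2) \<le> 2 ^ card S" using fin by (simp add: card_Pow)
  have "(\<Sum>y\<in>Pow S. \<Sum>z\<in>Pow T. a y * b z * (\<Prod>v\<in>y. \<Prod>t\<in>z. \<kappa> v t)) = (\<Sum>y\<in>Pow S. a y * g y)"
    unfolding g_def c_def sum_distrib_left by (simp add: mult.assoc)
  then have "(\<Sum>y\<in>Pow S. \<Sum>z\<in>Pow T. a y * b z * (\<Prod>v\<in>y. \<Prod>t\<in>z. \<kappa> v t))\<^sup>2
      \<le> (\<Sum>y\<in>Pow S. (a y)\<^sup>2) * (\<Sum>y\<in>Pow S. (g y)\<^sup>2)"
    using Cauchy_Schwarz_ineq_sum[of a g "Pow S"] by simp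
  also have "\<dots> \<le> 2 ^ card S * (2 ^ card T * (2 ^ (card T - card M) * 2 ^ card S))"
    by (intro mult_mono a2 g2) (auto intro: sum_nonneg)
  finally have "(\<Sum>y\<in>Pow S. \<Sum>z\<in>Pow T. a y * b z * (\<Prod>v\<in>y. \<Prod>t\<in>z. \<kappa> v t))\<^sup>2 * 2 ^ card M
      \<le> (2 ^ card S * (2 ^ card T * (2 ^ (card T - card M) * 2 ^ card S))) * 2 ^ card M"
    by (intro mult_right_mono) auto
  also have "\<dots> = 2 ^ card S * 2 ^ card S * 2 ^ card T * (2 ^ (card T - card M) * 2 ^ card M)"
    by (simp add: mult_ac)
  also have "(2::real) ^ (card T - card M) * 2 ^ card M = 2 ^ card T"
    using cMT by (simp flip: power_add)
  also have "(2::real) ^ card S * 2 ^ card S * 2 ^ card T * 2 ^ card T = 4 ^ (card S + card T)"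
    by (simp add: power_add power_mult_distrib[symmetric] mult.assoc)
  finally show ?thesis .
qed

text \<open>With \<open>x\<close> read as a 0/1 vector, this is the sign of the quadratic form over
  GF(2) that sums the products of the two entries over all edges.\<close>

definition edge_sign :: "('a \<times> 'a) set \<Rightarrow> 'a set \<Rightarrow> real" where
  "edge_sign E x = (-1) ^ card (E \<inter> x \<times> x)"

lemma edge_sign_abs [simp]: "\<bar>edge_sign E x\<bar> = 1"
  unfolding edge_sign_def by (simp add: power_abs)

lemma edge_sign_Un_edges:
  assumes "finite E" "finite E'" "E \<inter> E' = {}"
  shows "edge_sign (E \<union> E') x = edge_sign E x * edge_sign E' x"
proof -
  have "card ((E \<union> E') \<inter> x \<times> x) = card (E \<inter> x \<times> x) + card (E' \<inter> x \<times> x)"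
    unfolding Int_Un_distrib2 by (rule card_Un_disjoint) (use assms in auto)
  then show ?thesis unfolding edge_sign_def by (simp add: power_add)
qed

text \<open>The bilinear part of the quadratic form. A pair present in both directions contributes
  two signs, which cancel; hence the equivalence.\<close>

definition edge_char :: "('a \<times> 'a) set \<Rightarrow> 'a \<Rightarrow> 'a \<Rightarrow> real" where
  "edge_char E v t = (if (v, t) \<in> E \<longleftrightarrow> (t, v) \<in> E then 1 else -1)"

lemma edge_sign_Un:
  assumes "finite E" "finite y" "finite z" "y \<inter> z = {}"
  shows "edge_sign E (y \<union> z) = edge_sign E y * edge_sign E z * (\<Prod>v\<in>y. \<Prod>t\<in>z. edge_char E v t)"
proof -
  have box: "(-1) ^ card (E \<inter> A \<times> B) = (\<Prod>v\<in>A. \<Prod>t\<in>B. if (v, t) \<in> E then -1 else 1::real)"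
    if "finite A" "finite B" for A B
  proof -
    have "(\<Prod>v\<in>A. \<Prod>t\<in>B. if (v, t) \<in> E then -1 else 1::real) = (\<Prod>p\<in>A \<times> B. if p \<in> E then -1 else 1)"
      by (simp add: prod.cartesian_product case_prod_unfold)
    also have "\<dots> = (-1) ^ card (E \<inter> A \<times> B)"
      using that by (simp add: prod.If_cases Int_commute)
    finally show ?thesis by simp
  qed
  have fE: "finite (E \<inter> X)" for X using assms(1) by simp
  have split: "E \<inter> (y \<union> z) \<times> (y \<union> z) = (E \<inter> y \<times> y \<union> E \<inter> z \<times> z) \<union> (E \<inter> y \<times> z \<union> E \<inter> z \<times> y)"
    by blast
  have "card (E \<inter> (y \<union> z) \<times> (y \<union> z)) =
      card (E \<inter> y \<times> y \<union> E \<inter> z \<times> z) + card (E \<inter> y \<times> z \<union> E \<inter> z \<times> y)"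
    unfolding split by (rule card_Un_disjoint) (use fE assms(4) in \<open>simp, simp, blast\<close>)
  also have "card (E \<inter> y \<times> y \<union> E \<inter> z \<times> z) = card (E \<inter> y \<times> y) + card (E \<inter> z \<times> z)"
    by (rule card_Un_disjoint) (use fE assms(4) in \<open>simp, simp, blast\<close>)
  also have "card (E \<inter> y \<times> z \<union> E \<inter> z \<times> y) = card (E \<inter> y \<times> z) + card (E \<inter> z \<times> y)"
    by (rule card_Un_disjoint) (use fE assms(4) in \<open>simp, simp, blast\<close>)
  finally have "edge_sign E (y \<union> z) = edge_sign E y * edge_sign E z *
      ((-1) ^ card (E \<inter> y \<times> z) * (-1) ^ card (E \<inter> z \<times> y))"
    unfolding edge_sign_def by (simp add: power_add)
  also have "(-1) ^ card (E \<inter> y \<times> z) * (-1) ^ card (E \<inter> z \<times> y) = (\<Prod>v\<in>y. \<Prod>t\<in>z. edge_char E v t)"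
    unfolding box[OF assms(2,3)] box[OF assms(3,2)]
    by (subst (2) prod.swap) (auto simp: edge_char_def simp flip: prod.distrib intro!: prod.cong)
  finally show ?thesis .
qed

lemma sum_Pow_split:
  assumes "S \<subseteq> V"
  shows "(\<Sum>x\<in>Pow V. f x) = (\<Sum>y\<in>Pow S. \<Sum>z\<in>Pow (V - S). f (y \<union> z))"
proof -
  have "(\<Sum>x\<in>Pow V. f x) = (\<Sum>p\<in>Pow S \<times> Pow (V - S). f (fst p \<union> snd p))"
    by (rule sum.reindex_bij_witness[of _ "\<lambda>p. fst p \<union> snd p" "\<lambda>x. (x \<inter> S, x - S)"])
      (use assms in \<open>auto simp: Int_Diff_Un\<close>)
  then show ?thesis by (simp add: sum.cartesian_product case_prod_unfold)
qed

definition adjacent :: "('a \<times> 'a) set \<Rightarrow> 'a \<Rightarrow> 'a \<Rightarrow> bool" where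
  "adjacent E a b \<longleftrightarrow> (a, b) \<in> E \<or> (b, a) \<in> E"

text \<open>On a rectangle, membership and the signs of edges inside either side factor into weights
  of absolute value at most 1. Only the bilinear form across the cut remains, and
  \<open>asym\<close> prevents its edges from cancelling.\<close>

lemma rectangle_discrepancy:
  assumes V: "finite V" "S \<subseteq> V" "finite E" and R: "rectangle V S R"
    and asym: "\<And>v t. (v, t) \<in> E \<Longrightarrow> (t, v) \<notin> E"
    and M: "M \<subseteq> S \<times> (V - S)" "\<And>p q. (p, q) \<in> M \<Longrightarrow> adjacent E p q"
    and induced: "\<And>p q p' q'. (p, q) \<in> M \<Longrightarrow> (p', q') \<in> M \<Longrightarrow> (p, q) \<noteq> (p', q') \<Longrightarrow> \<not> adjacent E p q'"
  shows "(\<Sum>x\<in>R. edge_sign E x)\<^sup>2 * 2 ^ card M \<le> 4 ^ card V"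
proof -
  let ?T = "V - S"
  \<comment> \<open>\<open>A\<close> and \<open>B\<close> are the two factors of the
    rectangle.\<close>
  define A where "A y \<longleftrightarrow> (\<exists>z\<in>Pow ?T. y \<union> z \<in> R)" for y
  define B where "B z \<longleftrightarrow> (\<exists>y\<in>Pow S. y \<union> z \<in> R)" for z
  have in_R: "y \<union> z \<in> R \<longleftrightarrow> A y \<and> B z" if "y \<subseteq> S" "z \<subseteq> ?T" for y z
  proof
    assume "A y \<and> B z"
    then obtain z' y' where "z' \<subseteq> ?T" "y \<union> z' \<in> R" "y' \<subseteq> S" "y' \<union> z \<in> R"
      unfolding A_def B_def by blast
    moreover from this have "(y \<union> z') \<inter> S \<union> ((y' \<union> z) - S) = y \<union> z" using that by blast
    ultimately show "y \<union> z \<in> R" using R unfolding rectangle_def by metis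
  qed (use that in \<open>auto simp: A_def B_def\<close>)
  have fin: "finite S" "finite ?T" using V finite_subset by auto
  have RV: "R \<subseteq> Pow V" using R unfolding rectangle_def by simp
  have "(\<Sum>x\<in>R. edge_sign E x) = (\<Sum>x\<in>Pow V. if x \<in> R then edge_sign E x else 0)"
    using V RV by (simp add: sum.If_cases Int_absorb1)
  also have "\<dots> = (\<Sum>y\<in>Pow S. \<Sum>z\<in>Pow ?T. if y \<union> z \<in> R then edge_sign E (y \<union> z) else 0)"
    by (rule sum_Pow_split) (rule V)
  also have "\<dots> = (\<Sum>y\<in>Pow S. \<Sum>z\<in>Pow ?T. (if A y then edge_sign E y else 0) *
      (if B z then edge_sign E z else 0) * (\<Prod>v\<in>y. \<Prod>t\<in>z. edge_char E v t))"
  proof (intro sum.cong refl)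
    fix y z assume yz: "y \<in> Pow S" "z \<in> Pow ?T"
    have "finite y" "finite z" "y \<inter> z = {}"
      using yz finite_subset[OF _ fin(1)] finite_subset[OF _ fin(2)] by auto
    then show "(if y \<union> z \<in> R then edge_sign E (y \<union> z) else 0) =
      (if A y then edge_sign E y else 0) *
      (if B z then edge_sign E z else 0) * (\<Prod>v\<in>y. \<Prod>t\<in>z. edge_char E v t)"
      using in_R[of y z] yz edge_sign_Un[OF V(3)] by auto
  qed
  finally have eq: "(\<Sum>x\<in>R. edge_sign E x) = \<dots>" .
  have "card S + card ?T = card V"
    using V fin card_Un_disjoint[of S ?T] by (simp add: Un_absorb1)
  moreover have "(\<Sum>x\<in>R. edge_sign E x)\<^sup>2 * 2 ^ card M \<le> 4 ^ (card S + card ?T)"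
    unfolding eq
  proof (rule bilinear_discrepancy[OF fin])
    show "edge_char E p q = -1" if "(p, q) \<in> M" for p q
      using M(2)[OF that] asym unfolding adjacent_def edge_char_def by auto
    show "edge_char E p q' = 1" if "(p, q) \<in> M" "(p', q') \<in> M" "(p, q) \<noteq> (p', q')" for p q p' q'
      using induced[OF that] unfolding adjacent_def edge_char_def by auto
  qed (use M in \<open>auto simp: edge_char_def\<close>)
  ultimately show ?thesis by simp
qed

text \<open>Take a largest conflict-free set \<open>M\<close> of edges. Every edge of
  \<open>F\<close> conflicts with one in \<open>M\<close>, and bounded degree limits the conflicts
  of each edge to \<open>2 * d\<^sup>2\<close>. Only adjacency from a first to a second endpoint
  counts as a conflict, since edges within one side of a cut do no harm.\<close>

lemma induced_matching:
  assumes "finite F" and F: "\<And>p q. (p, q) \<in> F \<Longrightarrow> adjacent E p q"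
    and deg: "\<And>a. finite {b. adjacent E a b}" "\<And>a. card {b. adjacent E a b} \<le> d"
  shows "\<exists>M\<subseteq>F. card F \<le> 2 * d\<^sup>2 * card M \<and>
    (\<forall>p q p' q'. (p, q) \<in> M \<longrightarrow> (p', q') \<in> M \<longrightarrow> (p, q) \<noteq> (p', q') \<longrightarrow> \<not> adjacent E p q')"
proof -
  define I where "I M \<longleftrightarrow> M \<subseteq> F \<and> (\<forall>e\<in>M. \<forall>e'\<in>M. e \<noteq> e' \<longrightarrow> \<not> adjacent E (fst e) (snd e'))" for M
  have "I {}" by (simp add: I_def)
  moreover have "card M < Suc (card F)" if "I M" for M
    using that card_mono[OF assms(1)] unfolding I_def by (simp add: less_Suc_eq_le)
  ultimately obtain M where M: "I M" and max: "\<And>M'. I M' \<Longrightarrow> card M' \<le> card M"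
    using ex_has_greatest_nat[of I "{}" card "Suc (card F)"] by (auto intro: less_imp_le)
  have finM: "finite M" using M assms(1) finite_subset unfolding I_def by blast
  let ?N = "\<lambda>a. {b. adjacent E a b}"
  have sym: "adjacent E a b \<longleftrightarrow> adjacent E b a" for a b by (auto simp: adjacent_def)
  \<comment> \<open>A superset of the edges in conflict with \<open>e\<close>: the first endpoint is
    a neighbour of \<open>snd e\<close>, or the second one is a neighbour of \<open>fst e\<close>;
    the other endpoint is then one more step away.\<close>
  define K where "K e = Sigma (?N (snd e)) ?N \<union> prod.swap ` Sigma (?N (fst e)) ?N" for e
  have cS: "card (Sigma (?N a) ?N) \<le> d\<^sup>2" for a
  proof -
    have "card (Sigma (?N a) ?N) = (\<Sum>b\<in>?N a. card (?N b))" using deg by (intro card_SigmaI) auto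
    also have "\<dots> \<le> (\<Sum>b\<in>?N a. d)" by (intro sum_mono deg)
    also have "\<dots> \<le> d * d" using deg(2)[of a] by simp
    finally show ?thesis by (simp add: power2_eq_square)
  qed
  have finS: "finite (Sigma (?N a) ?N)" for a using deg by (intro finite_SigmaI) auto
  have cK: "finite (K e)" "card (K e) \<le> 2 * d\<^sup>2" for e
  proof -
    show "finite (K e)" unfolding K_def using finS by blast
    have "card (K e) \<le> card (Sigma (?N (snd e)) ?N) + card (prod.swap ` Sigma (?N (fst e)) ?N)"
      unfolding K_def by (rule card_Un_le)
    also have "\<dots> \<le> d\<^sup>2 + d\<^sup>2"
      by (intro add_mono cS order.trans[OF card_image_le[OF finS] cS])
    finally show "card (K e) \<le> 2 * d\<^sup>2" by simp
  qed
  have "F \<subseteq> (\<Union>e\<in>M. K e)"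
  proof
    fix e assume e: "e \<in> F"
    \<comment> \<open>A member of \<open>M\<close> is paired with itself, its own ends being
      adjacent; any other edge is blocked by maximality.\<close>
    have "\<exists>e'\<in>M. adjacent E (fst e) (snd e') \<or> adjacent E (fst e') (snd e)"
    proof (cases "e \<in> M")
      case True
      then show ?thesis using F[of "fst e" "snd e"] e by auto
    next
      case False
      then have "\<not> I (insert e M)" using max[of "insert e M"] finM by auto
      then show ?thesis using M e unfolding I_def by auto
    qed
    then obtain e' where e': "e' \<in> M" "adjacent E (fst e) (snd e') \<or> adjacent E (fst e') (snd e)" by blast
    have "adjacent E (fst e) (snd e)" using F[of "fst e" "snd e"] e by simp
    then have "e \<in> K e'"
      using e'(2) sym unfolding K_def
      by (cases e) (auto simp: image_iff)
    then show "e \<in> (\<Union>e\<in>M. K e)" using e' by blast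
  qed
  then have "card F \<le> card (\<Union>e\<in>M. K e)" using cK finM by (intro card_mono) auto
  also have "\<dots> \<le> (\<Sum>e\<in>M. card (K e))" by (rule card_UN_le[OF finM])
  also have "\<dots> \<le> 2 * d\<^sup>2 * card M" using sum_mono[of M "\<lambda>e. card (K e)" "\<lambda>_. 2 * d\<^sup>2"] cK by (simp add: mult.commute)
  finally show ?thesis using M unfolding I_def by (intro exI[of _ M]) fastforce
qed

section \<open>Permutations that expand balanced sets\<close>

definition boundary :: "nat \<Rightarrow> nat set \<Rightarrow> nat set" where
  "boundary k S = {i. Suc i < k \<and> (i \<in> S \<longleftrightarrow> Suc i \<notin> S)}"

lemma boundary_subset: "boundary k S \<subseteq> {..<k}"
  unfolding boundary_def by auto

lemma boundary_determines:
  assumes "S \<subseteq> {..<k}" "S' \<subseteq> {..<k}" "boundary k S = boundary k S'" "0 \<in> S \<longleftrightarrow> 0 \<in> S'"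
  shows "S = S'"
proof -
  have "i < k \<Longrightarrow> i \<in> S \<longleftrightarrow> i \<in> S'" for i
  proof (induction i)
    case (Suc i)
    then have "i \<in> boundary k S \<longleftrightarrow> i \<in> boundary k S'" using assms(3) by simp
    then show ?case using Suc unfolding boundary_def by auto
  qed (use assms in simp)
  then show ?thesis using assms(1,2) by blast
qed

text \<open>Give each set \<open>B\<close> the weight \<open>(1/20) ^ card B\<close>. The total
  weight is \<open>(21/20) ^ k\<close>, and every counted set weighs at least
  \<open>(1/20) ^ t\<close>.\<close>

lemma card_small_subsets:
  "real (card {B \<in> Pow {..<k}. card B \<le> t}) \<le> (21/20) ^ k * 20 ^ t"
proof -
  have "real (card {B \<in> Pow {..<k}. card B \<le> t}) * (1/20) ^ t = (\<Sum>B\<in>{B \<in> Pow {..<k}. card B \<le> t}. (1/20) ^ t)"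
    by simp
  also have "\<dots> \<le> (\<Sum>B\<in>{B \<in> Pow {..<k}. card B \<le> t}. (1/20) ^ card B)"
    by (intro sum_mono power_decreasing) auto
  also have "\<dots> \<le> (\<Sum>B\<in>Pow {..<k}. (1/20) ^ card B)"
    by (intro sum_mono2) auto
  also have "\<dots> = (21/20) ^ k"
    using sum_Pow_prod[of "{..<k}" "\<lambda>_. 1/20"] by simp
  finally show ?thesis by (simp add: power_divide field_simps)
qed

text \<open>A set is recovered from its boundary and one bit, the membership of 0; this bit is the
  factor 2.\<close>

lemma card_small_boundary:
  "real (card {S \<in> Pow {..<k}. card (boundary k S) \<le> t}) \<le> 2 * ((21/20) ^ k * 20 ^ t)"
proof -
  let ?D = "{B \<in> Pow {..<k}. card B \<le> t}"
  have "card {S \<in> Pow {..<k}. card (boundary k S) \<le> t} \<le> card ((UNIV :: bool set) \<times> ?D)"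
  proof (rule card_inj_on_le)
    show "inj_on (\<lambda>S. (0 \<in> S, boundary k S)) {S \<in> Pow {..<k}. card (boundary k S) \<le> t}"
    proof (rule inj_onI)
      fix S S' assume "S \<in> {S \<in> Pow {..<k}. card (boundary k S) \<le> t}"
        "S' \<in> {S \<in> Pow {..<k}. card (boundary k S) \<le> t}"
        "(0 \<in> S, boundary k S) = (0 \<in> S', boundary k S')"
      then show "S = S'" using boundary_determines[of S k S'] by simp
    qed
    show "(\<lambda>S. (0 \<in> S, boundary k S)) ` {S \<in> Pow {..<k}. card (boundary k S) \<le> t} \<subseteq> UNIV \<times> ?D"
      using boundary_subset by auto
  qed auto
  also have "\<dots> = 2 * card ?D" by (simp add: card_cartesian_product)
  finally show ?thesis using card_small_subsets[of k t] by linarith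
qed

section \<open>Counting permutations by the image of a set\<close>

lemma permutes_image_exists:
  assumes "finite A" "S \<subseteq> A" "S' \<subseteq> A" "card S = card S'"
  shows "\<exists>\<tau>. \<tau> permutes A \<and> \<tau> ` S = S'"
proof -
  have fin: "finite S" "finite S'" using assms finite_subset by auto
  obtain f where f: "bij_betw f S S'" using finite_same_card_bij[OF fin assms(4)] by blast
  have "card (A - S) = card (A - S')" using assms fin by (simp add: card_Diff_subset)
  then obtain g where g: "bij_betw g (A - S) (A - S')"
    using finite_same_card_bij[of "A - S" "A - S'"] assms(1) by blast
  define \<tau> where "\<tau> x = (if x \<in> S then f x else if x \<in> A then g x else x)" for x
  have 1: "bij_betw \<tau> S S'" using f by (rule bij_betw_cong[THEN iffD1, rotated]) (simp add: \<tau>_def)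
  have 2: "bij_betw \<tau> (A - S) (A - S')"
    using g by (rule bij_betw_cong[THEN iffD1, rotated]) (simp add: \<tau>_def)
  have "bij_betw \<tau> (S \<union> (A - S)) (S' \<union> (A - S'))" using 1 2 by (rule bij_betw_combine) blast
  then have "bij_betw \<tau> A A" using assms by (simp add: Un_absorb1)
  then have "\<tau> permutes A" using assms by (intro bij_imp_permutes) (auto simp: \<tau>_def)
  then show ?thesis using 1 by (auto simp: bij_betw_def)
qed

text \<open>Permutations fall into classes by the image of \<open>S\<close>. Composition with a
  permutation taking \<open>S'\<close> to \<open>X\<close> injects the class of \<open>S'\<close>
  into that of \<open>X\<close>, so the class of \<open>S'\<close> is no larger than the
  average.\<close>

lemma card_permutations_image:
  assumes A: "finite A" "S \<subseteq> A" "S' \<subseteq> A" "card S = card S'"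
  shows "card {\<rho>. \<rho> permutes A \<and> \<rho> ` S = S'} * (card A choose card S) \<le> fact (card A)"
proof -
  define N where "N X = {\<rho>. \<rho> permutes A \<and> \<rho> ` S = X}" for X
  let ?F = "{X. X \<subseteq> A \<and> card X = card S}"
  have finP: "finite {\<rho>. \<rho> permutes A}" using A(1) by (rule finite_permutations)
  then have finN: "finite (N X)" for X by (rule rev_finite_subset) (auto simp: N_def)
  have le: "card (N S') \<le> card (N X)" if X: "X \<in> ?F" for X
  proof -
    obtain \<tau> where \<tau>: "\<tau> permutes A" "\<tau> ` S' = X"
      using permutes_image_exists[of A S' X] A X by auto
    have "inj \<tau>" using \<tau>(1) by (rule permutes_inj)
    then have "inj_on ((\<circ>) \<tau>) (N S')" by (intro inj_onI) (simp add: fun.inj_map_strong fun_eq_iff inj_eq)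
    moreover have "(\<circ>) \<tau> ` N S' \<subseteq> N X"
      using \<tau> permutes_compose unfolding N_def by (auto simp: image_comp[symmetric])
    ultimately show ?thesis using finN by (rule card_inj_on_le)
  qed
  have "card (N S') * (card A choose card S) = (\<Sum>X\<in>?F. card (N S'))"
    using n_subsets[OF A(1), of "card S"] by simp
  also have "\<dots> \<le> (\<Sum>X\<in>?F. card (N X))" by (rule sum_mono) (rule le)
  also have "\<dots> = card (\<Union>X\<in>?F. N X)"
    by (rule card_UN_disjoint[symmetric]) (use A(1) finN in \<open>auto simp: N_def\<close>)
  also have "\<dots> \<le> card {\<rho>. \<rho> permutes A}"
    by (rule card_mono[OF finP]) (auto simp: N_def)
  also have "\<dots> = fact (card A)" using A(1) by (rule card_permutations[OF refl])
  finally show ?thesis unfolding N_def .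
qed

text \<open>For \<open>j\<close> up to half of \<open>k\<close>, the binomial is at least
  \<open>(k / j) ^ j\<close>, hence at least \<open>2 ^ j\<close>; larger \<open>j\<close> follow by
  symmetry.\<close>

lemma binomial_ge_powr_third:
  assumes "k \<le> 3 * j" "3 * j \<le> 2 * k" "0 < k"
  shows "2 powr (real k / 3) \<le> real (k choose j)"
proof -
  have *: "2 powr (real k / 3) \<le> real (k choose i)" if i: "k \<le> 3 * i" "2 * i \<le> k" for i
  proof -
    have "2 powr (real k / 3) \<le> 2 powr real i" using i by (intro powr_mono) auto
    also have "\<dots> = 2 ^ i" by (simp add: powr_realpow)
    also have "\<dots> \<le> (real k / real i) ^ i"
      using i assms(3) by (intro power_mono) (auto simp: field_simps simp flip: of_nat_mult)
    also have "\<dots> \<le> real (k choose i)" using i by (intro binomial_ge_n_over_k_pow_k) auto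
    finally show ?thesis .
  qed
  show ?thesis
  proof (cases "2 * j \<le> k")
    case False
    then have "2 powr (real k / 3) \<le> real (k choose (k - j))" using assms by (intro *) auto
    then show ?thesis using binomial_symmetric[of j k] assms by simp
  qed (use * assms in auto)
qed

text \<open>Few sets have a small boundary, and a random permutation maps a given balanced set to
  another given one with probability at most \<open>2 powr (- k / 3)\<close>.\<close>

lemma expanding_permutation:
  assumes k: "100 \<le> k"
  shows "\<exists>\<rho>. \<rho> permutes {..<k} \<and> (\<forall>S\<subseteq>{..<k}. balanced {..<k} S \<longrightarrow>
    k div 100 < card (boundary k S) \<or> k div 100 < card (boundary k (\<rho> -` S)))"
proof (rule ccontr)
  define t where "t = k div 100"
  define F where "F = {S \<in> Pow {..<k}. card (boundary k S) \<le> t}"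
  define N where "N p = {\<rho>. \<rho> permutes {..<k} \<and> \<rho> ` fst p = snd p}" for p
  \<comment> \<open>\<open>P\<close> lists the ways to fail: a balanced set and its image, both with
    small boundary. If no permutation expands, the classes \<open>N p\<close> cover all
    permutations, which the union bound refutes.\<close>
  define P where "P = {p \<in> F \<times> F. balanced {..<k} (fst p) \<and> card (fst p) = card (snd p)}"
  assume contra: "\<not> ?thesis"
  have "{\<rho>. \<rho> permutes {..<k}} \<subseteq> (\<Union>p\<in>P. N p)"
  proof
    fix \<rho> assume "\<rho> \<in> {\<rho>. \<rho> permutes {..<k}}"
    then have \<rho>: "\<rho> permutes {..<k}" by simp
    then obtain S where S: "S \<subseteq> {..<k}" "balanced {..<k} S" "card (boundary k S) \<le> t"
      "card (boundary k (\<rho> -` S)) \<le> t"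
      using contra unfolding t_def by force
    have sub: "\<rho> -` S \<subseteq> {..<k}" using S(1) permutes_in_image[OF \<rho>] by blast
    have im: "\<rho> ` (\<rho> -` S) = S" using permutes_surj[OF \<rho>] by (rule surj_image_vimage_eq)
    have "card (\<rho> -` S) = card S"
      using card_image[of \<rho> "\<rho> -` S"] permutes_inj[OF \<rho>] im by (metis inj_on_subset subset_UNIV)
    moreover have "S \<inter> {..<k} = S" "\<rho> -` S \<inter> {..<k} = \<rho> -` S" using S sub by auto
    ultimately have "balanced {..<k} (\<rho> -` S)" using S(2) unfolding balanced_def by simp
    then have "(\<rho> -` S, S) \<in> P"
      using S sub \<open>card (\<rho> -` S) = card S\<close> unfolding P_def F_def by simp
    moreover have "\<rho> \<in> N (\<rho> -` S, S)" using \<rho> im unfolding N_def by simp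
    ultimately show "\<rho> \<in> (\<Union>p\<in>P. N p)" by blast
  qed
  have finF: "finite F" unfolding F_def by simp
  then have finP: "finite P" unfolding P_def by simp
  have finN: "finite (N p)" for p
    using finite_permutations[of "{..<k}"] by (rule rev_finite_subset) (auto simp: N_def)
  have N: "real (card (N p)) * 2 powr (real k / 3) \<le> fact k" if p: "p \<in> P" for p
  proof -
    have sub: "fst p \<subseteq> {..<k}" "snd p \<subseteq> {..<k}" using p unfolding P_def F_def by auto
    have "fst p \<inter> {..<k} = fst p" using sub by auto
    then have "k \<le> 3 * card (fst p)" "3 * card (fst p) \<le> 2 * k"
      using p unfolding P_def balanced_def by auto
    then have "2 powr (real k / 3) \<le> real (k choose card (fst p))"
      using k by (intro binomial_ge_powr_third) auto
    then have "real (card (N p)) * 2 powr (real k / 3) \<le> real (card (N p)) * real (k choose card (fst p))"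
      by (intro mult_left_mono) auto
    also have "\<dots> = real (card (N p) * (k choose card (fst p)))" by simp
    also have "\<dots> \<le> real (fact k)"
      using card_permutations_image[of "{..<k}" "fst p" "snd p"] sub p
      unfolding N_def P_def by (intro of_nat_mono) simp
    finally show ?thesis by simp
  qed
  have "fact k = card {\<rho>. \<rho> permutes {..<k}}" by (simp add: card_permutations)
  also have "\<dots> \<le> card (\<Union>p\<in>P. N p)"
    using \<open>_ \<subseteq> (\<Union>p\<in>P. N p)\<close> finP finN by (intro card_mono) auto
  also have "\<dots> \<le> (\<Sum>p\<in>P. card (N p))" using finP by (rule card_UN_le)
  finally have "real (fact k) \<le> real (\<Sum>p\<in>P. card (N p))" by (rule of_nat_mono)
  then have "real (fact k) \<le> (\<Sum>p\<in>P. real (card (N p)))" by simp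
  then have "fact k * 2 powr (real k / 3) \<le> (\<Sum>p\<in>P. real (card (N p))) * 2 powr (real k / 3)"
    by (intro mult_right_mono) auto
  also have "\<dots> \<le> (\<Sum>p\<in>P. fact k)" unfolding sum_distrib_right by (intro sum_mono N)
  also have "\<dots> \<le> (real (card F))\<^sup>2 * fact k"
  proof -
    have "card P \<le> card (F \<times> F)" using finF unfolding P_def by (intro card_mono) auto
    then have "real (card P) \<le> (real (card F))\<^sup>2"
      by (simp add: card_cartesian_product power2_eq_square flip: of_nat_mult)
    then show ?thesis by simp
  qed
  finally have "2 powr (real k / 3) * fact k \<le> (real (card F))\<^sup>2 * fact k" by (simp add: mult.commute)
  then have le: "2 powr (real k / 3) \<le> (real (card F))\<^sup>2"
    by (rule mult_right_le_imp_le) simp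
  \<comment> \<open>The 14th power of 21/20 is just below 2.\<close>
  have "(21/20 :: real) ^ k \<le> 2 powr (real k / 14)"
  proof -
    have "(21/20 :: real) = ((21/20) powr 14) powr (1/14)" unfolding powr_powr by simp
    also have "(21/20 :: real) powr 14 = (21/20) ^ 14" by (rule powr_numeral) simp
    also have "\<dots> powr (1/14) \<le> 2 powr (1/14)" by (intro powr_mono2) (simp_all add: power_divide)
    finally have "(21/20 :: real) ^ k \<le> (2 powr (1/14)) ^ k" by (rule power_mono) simp
    also have "\<dots> = 2 powr (real k / 14)" by (simp add: powr_realpow[symmetric] powr_powr)
    finally show ?thesis .
  qed
  moreover have "(20 :: real) ^ t \<le> 2 powr (real k / 20)"
  proof -
    have "(20 :: real) ^ t \<le> (2 ^ 5) ^ t" by (rule power_mono) simp_all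
    also have "\<dots> = 2 ^ (5 * t)" by (rule power_mult[symmetric])
    also have "\<dots> = 2 powr (5 * real t)" using powr_realpow[of 2 "5 * t"] by simp
    also have "\<dots> \<le> 2 powr (real k / 20)"
    proof (rule powr_mono)
      have "100 * t \<le> k" unfolding t_def by linarith
      then show "5 * real t \<le> real k / 20" by linarith
    qed simp
    finally show ?thesis .
  qed
  ultimately have "real (card F) \<le> 2 * (2 powr (real k / 14) * 2 powr (real k / 20))"
    using card_small_boundary[of k t] unfolding F_def
    by (meson order.trans mult_left_mono mult_mono powr_ge_zero zero_le_numeral zero_le_power)
  also have "\<dots> = 2 powr (1 + (real k / 14 + real k / 20))" unfolding powr_add by simp
  finally have "(real (card F))\<^sup>2 \<le> (2 powr (1 + (real k / 14 + real k / 20)))\<^sup>2"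
    by (rule power_mono) simp
  also have "\<dots> = 2 powr (2 * (1 + (real k / 14 + real k / 20)))"
    by (simp only: power2_eq_square mult_2 powr_add)
  \<comment> \<open>The exponent on the left is \<open>2 + 17 * k / 70\<close>, and 17/70 is less
    than 1/3.\<close>
  also have "\<dots> < 2 powr (real k / 3)" using k by (intro powr_less_mono) auto
  finally show False using le by linarith
qed

section \<open>Path parities and the separating functions\<close>

text \<open>The flag \<open>l\<close> is the value of the vertex preceding the list.\<close>

fun path_parity :: "nat list \<Rightarrow> bool \<Rightarrow> (nat \<Rightarrow> bool) \<Rightarrow> bool" where
  "path_parity [] l \<sigma> = False"
| "path_parity (v # vs) l \<sigma> = ((l \<and> \<sigma> v) \<noteq> path_parity vs (\<sigma> v) \<sigma>)"

section \<open>Small circuits for path parities\<close>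

definition decide :: "nat \<Rightarrow> nnf \<Rightarrow> nnf \<Rightarrow> nnf" where
  "decide v A B = Or [And [Lit v True, A], And [Lit v False, B]]"

text \<open>A decision diagram of constant width: its state is the value \<open>l\<close> of the
  preceding vertex and the parity \<open>b\<close> still to be produced.\<close>

fun parity_circuit :: "nat list \<Rightarrow> bool \<Rightarrow> bool \<Rightarrow> nnf" where
  "parity_circuit [] l b = (if b then Bot else Top)"
| "parity_circuit (v # vs) l b = decide v (parity_circuit vs True (b \<noteq> l)) (parity_circuit vs False b)"

lemma eval_decide: "eval (decide v A B) \<sigma> \<longleftrightarrow> (if \<sigma> v then eval A \<sigma> else eval B \<sigma>)"
  unfolding decide_def by auto

lemma vars_decide: "vars (decide v A B) = insert v (vars A \<union> vars B)"
  unfolding decide_def by auto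

lemma nodes_decide: "nodes (decide v A B) =
  {decide v A B, And [Lit v True, A], And [Lit v False, B], Lit v True, Lit v False} \<union> nodes A \<union> nodes B"
  unfolding decide_def by auto

lemma is_dDNNF_decide:
  assumes "is_dDNNF A" "is_dDNNF B" "v \<notin> vars A" "v \<notin> vars B"
  shows "is_dDNNF (decide v A B)"
proof -
  have "decomposable [Lit v True, A]" "decomposable [Lit v False, B]"
    using assms(3,4) by (auto simp: decomposable_def less_Suc_eq nth_Cons')
  moreover have "deterministic [And [Lit v True, A], And [Lit v False, B]]"
    by (auto simp: deterministic_def less_Suc_eq nth_Cons')
  ultimately show ?thesis
    using assms(1,2) unfolding is_dDNNF_def nodes_decide by (auto simp: decide_def)
qed

lemma path_parity_cong:
  "(\<And>v. v \<in> set vs \<Longrightarrow> \<sigma> v = \<tau> v) \<Longrightarrow> path_parity vs l \<sigma> = path_parity vs l \<tau>"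
  by (induction vs arbitrary: l) auto

lemma eval_parity_circuit: "eval (parity_circuit vs l b) \<sigma> \<longleftrightarrow> path_parity vs l \<sigma> = b"
  by (induction vs arbitrary: l b) (auto simp: eval_decide)

lemma vars_parity_circuit: "vars (parity_circuit vs l b) \<subseteq> set vs"
  by (induction vs arbitrary: l b) (auto simp: vars_decide)

lemma is_dDNNF_parity_circuit: "distinct vs \<Longrightarrow> is_dDNNF (parity_circuit vs l b)"
proof (induction vs arbitrary: l b)
  case (Cons v vs)
  then show ?case by (auto intro!: is_dDNNF_decide dest: subsetD[OF vars_parity_circuit])
qed (auto simp: is_dDNNF_def)

text \<open>All four states are counted together because they share the circuits of the tail. Each
  vertex then adds at most 4 disjunctions, 4 conjunctions and 2 literals.\<close>

lemma card_nodes_parity_circuits: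
  "card (\<Union>(l, b)\<in>UNIV. nodes (parity_circuit vs l b)) \<le> 10 * length vs + 2"
proof (induction vs)
  case Nil
  have "(\<Union>(l, b)\<in>UNIV. nodes (parity_circuit [] l b)) \<subseteq> {Top, Bot}" by (auto split: if_splits)
  from card_mono[OF _ this] show ?case by simp
next
  case (Cons v vs)
  let ?N = "\<Union>(l, b)\<in>UNIV. nodes (parity_circuit vs l b)"
  let ?A = "(\<lambda>(l, b). parity_circuit (v # vs) l b) ` UNIV"
  let ?B = "(\<lambda>(l, b). And [Lit v l, parity_circuit vs l b]) ` UNIV"
  let ?C = "Lit v ` UNIV"
  have "(\<Union>(l, b)\<in>UNIV. nodes (parity_circuit (v # vs) l b)) \<subseteq> ?N \<union> (?A \<union> (?B \<union> ?C))"
    by (auto simp: nodes_decide image_iff split: prod.splits)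
  moreover have "finite (?N \<union> (?A \<union> (?B \<union> ?C)))" by auto
  ultimately have "card (\<Union>(l, b)\<in>UNIV. nodes (parity_circuit (v # vs) l b)) \<le> card (?N \<union> (?A \<union> (?B \<union> ?C)))"
    by (intro card_mono)
  also have "\<dots> \<le> card ?N + (card ?A + (card ?B + card ?C))"
    by (intro order.trans[OF card_Un_le] add_left_mono order.refl)
  also have "\<dots> \<le> (10 * length vs + 2) + (4 + (4 + 2))"
  proof (intro add_mono Cons)
    show "card ?A \<le> 4" "card ?B \<le> 4" "card ?C \<le> 2"
      by (rule order.trans[OF card_image_le], simp, simp add: card_UNIV_bool flip: UNIV_Times_UNIV)+
  qed
  finally show ?case by simp
qed

lemma nodes_parity_circuit_children:
  "s \<in> nodes (parity_circuit vs l b) \<Longrightarrow> length (children s) \<le> 2"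
  by (induction vs arbitrary: l b) (auto simp: nodes_decide decide_def split: if_splits)

lemma size_decide_parity_circuits:
  "size_nnf (decide v (parity_circuit us l b) (parity_circuit ws l' b')) \<le> 30 * (length us + length ws) + 27"
proof -
  let ?D = "decide v (parity_circuit us l b) (parity_circuit ws l' b')"
  define I where "I = {?D, And [Lit v True, parity_circuit us l b], And [Lit v False, parity_circuit ws l' b'],
    Lit v True, Lit v False}"
  have cN: "card (nodes (parity_circuit vs l b)) \<le> 10 * length vs + 2" for vs l b
    by (rule order.trans[OF card_mono card_nodes_parity_circuits]) auto
  have "card I \<le> 5" unfolding I_def by (simp add: card_insert_if)
  have "card (nodes ?D) \<le> card I + card (nodes (parity_circuit us l b)) + card (nodes (parity_circuit ws l' b'))"
    unfolding nodes_decide I_def[symmetric] by (intro order.trans[OF card_Un_le] add_right_mono order.refl)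
  also have "\<dots> \<le> 5 + (10 * length us + 2) + (10 * length ws + 2)"
    by (intro add_mono cN \<open>card I \<le> 5\<close>)
  finally have "card (nodes ?D) \<le> 10 * (length us + length ws) + 9" by simp
  \<comment> \<open>Each node counts for itself and at most two outgoing edges.\<close>
  moreover have "size_nnf ?D \<le> (\<Sum>s\<in>nodes ?D. 3)"
    unfolding size_nnf_def
  proof (rule sum_mono)
    fix s assume "s \<in> nodes ?D"
    then have "length (children s) \<le> 2"
      using nodes_parity_circuit_children unfolding nodes_decide by (auto simp: decide_def)
    then show "1 + length (children s) \<le> 3" by simp
  qed
  ultimately show ?thesis by simp
qed

section \<open>Path parities as edge signs\<close>

definition path_edges :: "'a list \<Rightarrow> ('a \<times> 'a) set" where
  "path_edges vs = set (zip vs (tl vs))"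

lemma path_edges_map_upt: "path_edges (map h [0..<k]) = {(h i, h (Suc i)) |i. Suc i < k}"
proof -
  have "zip (map h [0..<k]) (tl (map h [0..<k])) = map (\<lambda>i. (h i, h (Suc i))) [0..<k - 1]"
    by (intro nth_equalityI) (auto simp: nth_tl)
  then show ?thesis unfolding path_edges_def by (auto simp: image_iff less_diff_conv)
qed

lemma edge_sign_insert:
  assumes "finite E" "e \<notin> E"
  shows "edge_sign (insert e E) x = (if fst e \<in> x \<and> snd e \<in> x then -1 else 1) * edge_sign E x"
proof -
  have "edge_sign (insert e E) x = edge_sign {e} x * edge_sign E x"
    using edge_sign_Un_edges[of "{e}" E x] assms by simp
  then show ?thesis by (cases e) (auto simp: edge_sign_def)
qed

text \<open>The extra factor is the edge entering the path from the preceding vertex; for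
  \<open>l = False\<close> it disappears. Distinctness matters because \<open>edge_sign\<close>
  counts a set of edges, the parity a list.\<close>

lemma path_parity_sign:
  "distinct vs \<Longrightarrow> (if path_parity vs l (\<lambda>v. v \<in> x) then -1 else 1) =
    (if l \<and> vs \<noteq> [] \<and> hd vs \<in> x then -1 else 1) * edge_sign (path_edges vs) x"
proof (induction vs arbitrary: l)
  case (Cons v vs)
  show ?case
  proof (cases vs)
    case Nil
    then show ?thesis by (simp add: path_edges_def edge_sign_def)
  next
    case (Cons u ws)
    have "(v, u) \<notin> path_edges vs" using Cons.prems by (auto simp: path_edges_def dest: set_zip_leftD)
    moreover have "path_edges (v # vs) = insert (v, u) (path_edges vs)" "finite (path_edges vs)"
      using Cons by (auto simp: path_edges_def)
    ultimately have "edge_sign (path_edges (v # vs)) x =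
        (if v \<in> x \<and> u \<in> x then -1 else 1) * edge_sign (path_edges vs) x"
      by (simp add: edge_sign_insert)
    moreover have "(if path_parity vs (v \<in> x) (\<lambda>v. v \<in> x) then -1 else 1) =
        (if v \<in> x \<and> u \<in> x then -1 else 1) * edge_sign (path_edges vs) x"
      using Cons.IH[of "v \<in> x"] Cons.prems Cons by simp
    ultimately have "edge_sign (path_edges (v # vs)) x = (if path_parity vs (v \<in> x) (\<lambda>v. v \<in> x) then -1 else 1)"
      by simp
    then show ?thesis by (cases "v \<in> x") simp_all
  qed
qed (simp add: path_edges_def edge_sign_def)

text \<open>The second path visits only even vertices, so the two paths share no edge and no
  edge cancels in the sum of the parities.\<close>

locale two_paths =
  fixes k :: nat and \<rho> :: "nat \<Rightarrow> nat"
  assumes perm: "\<rho> permutes {..<k}"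
begin

definition path0 :: "nat list" where "path0 = [0..<2 * k]"
definition path1 :: "nat list" where "path1 = map (\<lambda>i. 2 * \<rho> i) [0..<k]"
definition graph :: "(nat \<times> nat) set" where "graph = path_edges path0 \<union> path_edges path1"

lemma path0_edges: "path_edges path0 = {(i, Suc i) |i. Suc i < 2 * k}"
  using path_edges_map_upt[of "\<lambda>i. i" "2 * k"] by (simp add: path0_def)

lemma path1_edges: "path_edges path1 = {(2 * \<rho> i, 2 * \<rho> (Suc i)) |i. Suc i < k}"
  unfolding path1_def by (rule path_edges_map_upt)

lemma \<rho>_eq_iff: "\<rho> i = \<rho> j \<longleftrightarrow> i = j"
  using permutes_inj[OF perm] by (auto dest: injD)

lemma \<rho>_less: "i < k \<Longrightarrow> \<rho> i < k"
  using permutes_in_image[OF perm, of i] by simp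

lemma distinct_paths: "distinct path0" "distinct path1"
  unfolding path0_def path1_def by (auto simp: distinct_map inj_on_def \<rho>_eq_iff)

lemma set_paths: "set path0 = {..<2 * k}" "set path1 \<subseteq> {..<2 * k}"
  unfolding path0_def path1_def using \<rho>_less by (auto simp: atLeast0LessThan)

lemma length_paths: "length path0 = 2 * k" "length path1 = k"
  unfolding path0_def path1_def by auto

lemma finite_edges [simp]: "finite (path_edges vs)"
  by (simp add: path_edges_def)

lemma disjoint_edges: "path_edges path0 \<inter> path_edges path1 = {}"
proof -
  have "even b \<longleftrightarrow> odd a" if "(a, b) \<in> path_edges path0" for a b using that by (auto simp: path0_edges)
  moreover have "even a \<and> even b" if "(a, b) \<in> path_edges path1" for a b using that by (auto simp: path1_edges)
  ultimately show ?thesis by fast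
qed

text \<open>An edge of the first path joins vertices of different parity and steps upwards; one of
  the second joins even vertices and steps forward in the order given by \<open>\<rho>\<close>.
  Neither can be reversed, so no sign cancels in \<open>edge_char\<close>.\<close>

lemma graph_asym: "(a, b) \<in> graph \<Longrightarrow> (b, a) \<notin> graph"
proof
  assume ab: "(a, b) \<in> graph" "(b, a) \<in> graph"
  have 0: "(x, y) \<in> path_edges path0 \<Longrightarrow> y = Suc x" for x y by (auto simp: path0_edges)
  have 1: "(x, y) \<in> path_edges path1 \<Longrightarrow> even x \<and> even y" for x y by (auto simp: path1_edges)
  have "(a, b) \<in> path_edges path1 \<and> (b, a) \<in> path_edges path1"
    using ab 0[of a b] 0[of b a] 1[of a b] 1[of b a] unfolding graph_def by auto
  then obtain i j where "2 * \<rho> i = 2 * \<rho> (Suc j)" "2 * \<rho> (Suc i) = 2 * \<rho> j"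
    unfolding path1_edges by auto
  then show False by (simp add: \<rho>_eq_iff)
qed

text \<open>For even \<open>a\<close>, \<open>inv \<rho> (a div 2)\<close> is the position of
  \<open>a\<close> on the second path. Only an inclusion is claimed, which suffices to bound the
  degree by 4.\<close>

lemma graph_neighbours:
  "{b. adjacent graph a b} \<subseteq>
    {Suc a, a - 1, 2 * \<rho> (Suc (inv \<rho> (a div 2))), 2 * \<rho> (inv \<rho> (a div 2) - 1)}"
  by (auto simp: adjacent_def graph_def path0_edges path1_edges permutes_inverses[OF perm])

lemma graph_degree: "finite {b. adjacent graph a b}" "card {b. adjacent graph a b} \<le> 4"
proof -
  show "finite {b. adjacent graph a b}" by (rule finite_subset[OF graph_neighbours]) simp
  show "card {b. adjacent graph a b} \<le> 4"
    by (rule order.trans[OF card_mono[OF _ graph_neighbours]]) (auto simp: card_insert_if)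
qed

definition evens :: "nat set" where "evens = (*) 2 ` {..<k}"

definition cut :: "nat set \<Rightarrow> (nat \<times> nat) set" where
  "cut S = {(p, q). p \<in> S \<and> q \<in> {..<2 * k} - S \<and> adjacent graph p q}"

lemma finite_cut: "S \<subseteq> {..<2 * k} \<Longrightarrow> finite (cut S)"
  by (rule finite_subset[of _ "{..<2 * k} \<times> {..<2 * k}"]) (auto simp: cut_def)

text \<open>If \<open>2 * i\<close> and \<open>2 * Suc i\<close> lie on different sides, one of the
  two edges through the odd vertex between them crosses the cut, whichever side that vertex is on.
  Halving the smaller end of this edge gives back \<open>i\<close>.\<close>

lemma boundary_le_cut:
  assumes "S \<subseteq> {..<2 * k}"
  shows "card (boundary k {u. 2 * u \<in> S}) \<le> card (cut S)"
proof (rule surj_card_le[OF finite_cut[OF assms]])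
  show "boundary k {u. 2 * u \<in> S} \<subseteq> (\<lambda>(p, q). min p q div 2) ` cut S"
  proof
    fix i assume i: "i \<in> boundary k {u. 2 * u \<in> S}"
    then have lt: "Suc i < k" and ne: "2 * i \<in> S \<longleftrightarrow> 2 * Suc i \<notin> S" unfolding boundary_def by auto
    have adj: "adjacent graph (2 * i) (Suc (2 * i))" "adjacent graph (Suc (2 * i)) (2 * i)"
      "adjacent graph (Suc (2 * i)) (2 * Suc i)" "adjacent graph (2 * Suc i) (Suc (2 * i))"
      using lt by (auto simp: adjacent_def graph_def path0_edges)
    have "(2 * i, Suc (2 * i)) \<in> cut S \<or> (Suc (2 * i), 2 * i) \<in> cut S \<or>
        (Suc (2 * i), 2 * Suc i) \<in> cut S \<or> (2 * Suc i, Suc (2 * i)) \<in> cut S"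
      using ne lt adj unfolding cut_def by auto
    then show "i \<in> (\<lambda>(p, q). min p q div 2) ` cut S" by (elim disjE) (force simp: image_iff)+
  qed
qed

text \<open>Here the even vertices are joined directly, and the position on the second path is read
  back through \<open>inv \<rho>\<close>.\<close>

lemma permuted_boundary_le_cut:
  assumes "S \<subseteq> {..<2 * k}"
  shows "card (boundary k (\<rho> -` {u. 2 * u \<in> S})) \<le> card (cut S)"
proof (rule surj_card_le[OF finite_cut[OF assms]])
  let ?h = "\<lambda>(p, q). min (inv \<rho> (p div 2)) (inv \<rho> (q div 2))"
  show "boundary k (\<rho> -` {u. 2 * u \<in> S}) \<subseteq> ?h ` cut S"
  proof
    fix i assume i: "i \<in> boundary k (\<rho> -` {u. 2 * u \<in> S})"
    then have lt: "Suc i < k" and ne: "2 * \<rho> i \<in> S \<longleftrightarrow> 2 * \<rho> (Suc i) \<notin> S" unfolding boundary_def by auto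
    have adj: "adjacent graph (2 * \<rho> i) (2 * \<rho> (Suc i))" "adjacent graph (2 * \<rho> (Suc i)) (2 * \<rho> i)"
      using lt unfolding adjacent_def graph_def path1_edges by blast+
    have "(2 * \<rho> i, 2 * \<rho> (Suc i)) \<in> cut S \<or> (2 * \<rho> (Suc i), 2 * \<rho> i) \<in> cut S"
      using ne lt adj \<rho>_less[of i] \<rho>_less[of "Suc i"] unfolding cut_def by auto
    moreover have "i = ?h (2 * \<rho> i, 2 * \<rho> (Suc i))" "i = ?h (2 * \<rho> (Suc i), 2 * \<rho> i)"
      by (simp_all add: permutes_inverses[OF perm])
    ultimately show "i \<in> ?h ` cut S" by (elim disjE) (rule image_eqI, assumption, assumption)+
  qed
qed

end

section \<open>The exponential lower bound\<close>

locale expanding_paths = two_paths +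
  assumes k_ge: "100 \<le> k"
    and expanding: "\<And>S. S \<subseteq> {..<k} \<Longrightarrow> balanced {..<k} S \<Longrightarrow>
      k div 100 < card (boundary k S) \<or> k div 100 < card (boundary k (\<rho> -` S))"
begin

lemma card_evens: "card evens = k"
  unfolding evens_def by (simp add: card_image inj_on_def)

lemma balanced_cut:
  assumes "S \<subseteq> {..<2 * k}" "balanced evens S"
  shows "k div 100 < card (cut S)"
proof -
  let ?U = "{u. 2 * u \<in> S}"
  have U: "?U \<subseteq> {..<k}" using assms(1) by auto
  have "S \<inter> evens = (*) 2 ` (?U \<inter> {..<k})" unfolding evens_def by auto
  then have "card (S \<inter> evens) = card (?U \<inter> {..<k})" by (simp add: card_image inj_on_def)
  then have "balanced {..<k} ?U" using assms(2) card_evens unfolding balanced_def by simp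
  then show ?thesis
    using expanding[OF U] boundary_le_cut[OF assms(1)] permuted_boundary_le_cut[OF assms(1)] by linarith
qed

lemma balanced_rectangle_discrepancy:
  assumes S: "S \<subseteq> {..<2 * k}" "balanced evens S" and R: "rectangle {..<2 * k} S R"
  shows "\<bar>\<Sum>x\<in>R. edge_sign graph x\<bar> * 2 powr (real k / 6400) \<le> 4 ^ k"
proof -
  obtain M where M: "M \<subseteq> cut S" "card (cut S) \<le> 2 * 4\<^sup>2 * card M"
    and ind: "\<And>p q p' q'. (p, q) \<in> M \<Longrightarrow> (p', q') \<in> M \<Longrightarrow> (p, q) \<noteq> (p', q') \<Longrightarrow> \<not> adjacent graph p q'"
    using induced_matching[OF finite_cut[OF S(1)], of graph 4] graph_degree unfolding cut_def by blast
  have "(\<Sum>x\<in>R. edge_sign graph x)\<^sup>2 * 2 ^ card M \<le> 4 ^ card {..<2 * k}"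
  proof (rule rectangle_discrepancy[OF _ S(1) _ R])
    show "finite graph" by (simp add: graph_def)
    show "M \<subseteq> S \<times> ({..<2 * k} - S)" using M(1) unfolding cut_def by auto
    show "adjacent graph p q" if "(p, q) \<in> M" for p q using M(1) that unfolding cut_def by auto
  qed (use ind graph_asym in auto)
  then have sq: "(\<Sum>x\<in>R. edge_sign graph x)\<^sup>2 * 2 ^ card M \<le> (4 ^ k)\<^sup>2"
    by (simp add: power_mult[symmetric] mult.commute)
  \<comment> \<open>The cut has more than \<open>k div 100\<close> edges, and degree 4 costs a
    factor 32 in passing to the induced matching. Taking the square root then turns 3200 into
    6400.\<close>
  have "k \<le> 100 * (32 * card M)" using balanced_cut[OF S] M(2) by simp
  then have "real k / 3200 \<le> real (card M)" by simp
  then have "2 powr (real k / 3200) \<le> 2 ^ card M"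
    by (simp add: powr_realpow[symmetric])
  then have "(\<Sum>x\<in>R. edge_sign graph x)\<^sup>2 * 2 powr (real k / 3200) \<le> (4 ^ k)\<^sup>2"
    by (intro order.trans[OF mult_left_mono sq]) auto
  moreover have "2 powr (real k / 3200) = (2 powr (real k / 6400))\<^sup>2"
    by (simp add: power2_eq_square flip: powr_add)
  ultimately have "(\<bar>\<Sum>x\<in>R. edge_sign graph x\<bar> * 2 powr (real k / 6400))\<^sup>2 \<le> (4 ^ k)\<^sup>2"
    by (simp add: power_mult_distrib)
  then show ?thesis by (rule power2_le_imp_le) simp
qed

lemma size_lower_bound:
  assumes C: "is_dDNNF C"
    "\<And>\<sigma>. eval C \<sigma> \<longleftrightarrow> path_parity path0 False \<sigma> = a \<or> path_parity path1 False \<sigma> = b"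
    and many: "4 ^ k \<le> 4 * card {x \<in> Pow {..<2 * k}. \<not> eval C (\<lambda>v. v \<in> x)}"
  shows "2 powr (real k / 6400) \<le> 8 * (real (size_nnf C))\<^sup>2"
proof -
  let ?V = "{..<2 * k}" and ?s = "edge_sign graph" and ?Q = "2 powr (real k / 6400)"
  let ?L = "nodes C \<times> nodes C"
  define X where "X = {x \<in> Pow ?V. eval C (\<lambda>v. v \<in> x)}"
  define Y where "Y = {x \<in> Pow ?V. \<not> eval C (\<lambda>v. v \<in> x)}"
  have E: "evens \<subseteq> ?V" "finite evens" unfolding evens_def by auto
  obtain R where R: "(\<Union>l\<in>?L. R l) = X" "disjoint_family_on R ?L"
    "\<And>l. \<exists>S\<subseteq>?V. balanced evens S \<and> rectangle ?V S (R l)"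
    using dDNNF_rectangle_partition[OF C(1) _ E(1)] card_evens k_ge unfolding X_def by force
  have bound: "\<bar>\<Sum>x\<in>R l. ?s x\<bar> * ?Q \<le> 4 ^ k" for l
    using R(3)[of l] balanced_rectangle_discrepancy by blast
  have finR: "finite (R l)" if "l \<in> ?L" for l
  proof (rule finite_subset)
    show "R l \<subseteq> Pow ?V" using R(1) that unfolding X_def by blast
  qed simp
  have "(\<Sum>x\<in>X. ?s x) = (\<Sum>l\<in>?L. \<Sum>x\<in>R l. ?s x)"
    unfolding R(1)[symmetric]
    by (rule sum.UNION_disjoint_family) (use R(2) finR in auto)
  then have "\<bar>\<Sum>x\<in>X. ?s x\<bar> * ?Q \<le> (\<Sum>l\<in>?L. \<bar>\<Sum>x\<in>R l. ?s x\<bar>) * ?Q"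
    by (intro mult_right_mono) (auto intro: sum_abs)
  also have "\<dots> \<le> (\<Sum>l\<in>?L. 4 ^ k)" unfolding sum_distrib_right by (intro sum_mono bound)
  also have "\<dots> = (real (card (nodes C)))\<^sup>2 * 4 ^ k"
    by (simp add: card_cartesian_product power2_eq_square)
  also have "\<dots> \<le> (real (size_nnf C))\<^sup>2 * 4 ^ k"
    using card_nodes_le[of C] by (intro mult_right_mono power_mono) auto
  finally have sumX: "\<bar>\<Sum>x\<in>X. ?s x\<bar> * ?Q \<le> (real (size_nnf C))\<^sup>2 * 4 ^ k" .
  have "\<exists>S\<subseteq>?V. balanced evens S"
    using R(3)[of "(C, C)"] by blast
  then obtain S where "S \<subseteq> ?V" "balanced evens S" by blast
  \<comment> \<open>The whole cube is a rectangle for any cut, so the total sum of the signs is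
    small as well.\<close>
  then have sumV: "\<bar>\<Sum>x\<in>Pow ?V. ?s x\<bar> * ?Q \<le> 4 ^ k"
    by (intro balanced_rectangle_discrepancy[of S]) (auto simp: rectangle_def)
  have sign: "?s x = (if path_parity path0 False (\<lambda>v. v \<in> x) then -1 else 1) *
      (if path_parity path1 False (\<lambda>v. v \<in> x) then -1 else 1)" for x
    unfolding path_parity_sign[OF distinct_paths(1)] path_parity_sign[OF distinct_paths(2)]
    using disjoint_edges by (simp add: graph_def edge_sign_Un_edges)
  \<comment> \<open>A countermodel has both path parities fixed, to the negations of
    \<open>a\<close> and \<open>b\<close>, so its sign is known.\<close>
  have "?s x = (if a = b then 1 else -1)" if "x \<in> Y" for x
    using that unfolding sign Y_def C(2) by auto
  then have "(\<Sum>x\<in>Y. ?s x) = (\<Sum>x\<in>Y. if a = b then 1 else -1)" by (rule sum.cong[OF refl])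
  then have sumY: "\<bar>\<Sum>x\<in>Y. ?s x\<bar> = real (card Y)" by (simp split: if_splits)
  have "(\<Sum>x\<in>Pow ?V. ?s x) = (\<Sum>x\<in>X \<union> Y. ?s x)"
    by (rule sum.cong) (auto simp: X_def Y_def)
  also have "\<dots> = (\<Sum>x\<in>X. ?s x) + (\<Sum>x\<in>Y. ?s x)"
    by (rule sum.union_disjoint) (auto simp: X_def Y_def)
  finally have "real (card Y) \<le> \<bar>\<Sum>x\<in>X. ?s x\<bar> + \<bar>\<Sum>x\<in>Pow ?V. ?s x\<bar>" using sumY by linarith
  then have "real (card Y) * ?Q \<le> (\<bar>\<Sum>x\<in>X. ?s x\<bar> + \<bar>\<Sum>x\<in>Pow ?V. ?s x\<bar>) * ?Q"
    by (rule mult_right_mono) simp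
  also have "\<dots> \<le> ((real (size_nnf C))\<^sup>2 + 1) * 4 ^ k"
    using sumX sumV by (simp add: distrib_right)
  \<comment> \<open>A circuit has at least one node, so the summand 1 from the whole cube is
    absorbed.\<close>
  also have "\<dots> \<le> (2 * (real (size_nnf C))\<^sup>2) * 4 ^ k"
  proof -
    have "0 < card (nodes C)" using nodes_refl[of C] by (metis card_gt_0_iff empty_iff finite_nodes)
    then have "1 \<le> real (size_nnf C)" using card_nodes_le[of C] by linarith
    then have "1 \<le> (real (size_nnf C))\<^sup>2" by (rule one_le_power)
    then show ?thesis by (intro mult_right_mono) auto
  qed
  finally have Y: "real (card Y) * ?Q \<le> (2 * (real (size_nnf C))\<^sup>2) * 4 ^ k" .
  have "real (4 ^ k) \<le> real (4 * card Y)" using many unfolding Y_def by (rule of_nat_mono)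
  then have "4 ^ k * ?Q \<le> 4 * real (card Y) * ?Q" by (intro mult_right_mono) auto
  then have "?Q * 4 ^ k \<le> 4 * (real (card Y) * ?Q)" by (simp only: mult_ac)
  also have "\<dots> \<le> 4 * ((2 * (real (size_nnf C))\<^sup>2) * 4 ^ k)" using Y by (rule mult_left_mono) simp
  also have "\<dots> = (8 * (real (size_nnf C))\<^sup>2) * 4 ^ k" by simp
  finally have "?Q * 4 ^ k \<le> (8 * (real (size_nnf C))\<^sup>2) * 4 ^ k" .
  then show ?thesis by (rule mult_right_le_imp_le) simp
qed

end

section \<open>Choice of the target parities and the two families\<close>

lemma exists_popular_pair:
  fixes p q :: "'a \<Rightarrow> bool"
  assumes "finite A"
  shows "\<exists>a b. card A \<le> 4 * card {x \<in> A. p x \<noteq> a \<and> q x \<noteq> b}"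
proof (rule ccontr)
  \<comment> \<open>The four classes cover \<open>A\<close>, so one of them holds at least a
    quarter. It becomes the set of countermodels: \<open>a\<close> and \<open>b\<close> are the
    values avoided on it.\<close>
  define X where "X a b = {x \<in> A. p x \<noteq> a \<and> q x \<noteq> b}" for a b
  assume "\<not> ?thesis"
  then have lt: "4 * card (X a b) < card A" for a b unfolding X_def by (meson not_le)
  have "(X True True \<union> X True False) \<union> (X False True \<union> X False False) = A" unfolding X_def by auto
  then have "card A \<le> (card (X True True) + card (X True False)) +
      (card (X False True) + card (X False False))"
    using card_Un_le[of "X True True" "X True False"] card_Un_le[of "X False True" "X False False"]
      card_Un_le[of "X True True \<union> X True False" "X False True \<union> X False False"] by simp
  then show False using lt[of True True] lt[of True False] lt[of False True] lt[of False False] by linarith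
qed

definition two_path_function :: "nat \<Rightarrow> (nat \<Rightarrow> nat) \<Rightarrow> bool \<Rightarrow> bool \<Rightarrow> (nat \<Rightarrow> bool) \<Rightarrow> bool" where
  "two_path_function k \<rho> a b \<sigma> \<longleftrightarrow>
    path_parity (two_paths.path0 k) False \<sigma> = a \<or> path_parity (two_paths.path1 k \<rho>) False \<sigma> = b"

text \<open>Below 100 any permutation will do; including these \<open>k\<close> lets one choose
  \<open>\<rho>\<close>, \<open>a\<close> and \<open>b\<close> as functions of
  \<open>k\<close>.\<close>

lemma hard_two_path_function:
  "\<exists>\<rho> a b. \<rho> permutes {..<k} \<and> (100 \<le> k \<longrightarrow>
    (\<forall>C. is_dDNNF C \<and> eval C = two_path_function k \<rho> a b \<longrightarrow>
      2 powr (real k / 6400) \<le> 8 * (real (size_nnf C))\<^sup>2))"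
proof (cases "100 \<le> k")
  case True
  then obtain \<rho> where \<rho>: "\<rho> permutes {..<k}" "\<And>S. S \<subseteq> {..<k} \<Longrightarrow> balanced {..<k} S \<Longrightarrow>
      k div 100 < card (boundary k S) \<or> k div 100 < card (boundary k (\<rho> -` S))"
    using expanding_permutation by blast
  interpret expanding_paths k \<rho> by unfold_locales (use True \<rho> in auto)
  obtain a b where ab: "card (Pow {..<2 * k}) \<le>
      4 * card {x \<in> Pow {..<2 * k}. path_parity path0 False (\<lambda>v. v \<in> x) \<noteq> a \<and>
        path_parity path1 False (\<lambda>v. v \<in> x) \<noteq> b}"
    using exists_popular_pair[of "Pow {..<2 * k}"] by force
  have "2 powr (real k / 6400) \<le> 8 * (real (size_nnf C))\<^sup>2"
    if "is_dDNNF C" "eval C = two_path_function k \<rho> a b" for C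
  proof (rule size_lower_bound)
    show "4 ^ k \<le> 4 * card {x \<in> Pow {..<2 * k}. \<not> eval C (\<lambda>v. v \<in> x)}"
      using ab unfolding that(2) two_path_function_def by (simp add: card_Pow power_mult)
  qed (use that in \<open>auto simp: two_path_function_def\<close>)
  then show ?thesis using \<rho>(1) by blast
qed (use permutes_id in blast)

theorem theorem1:
  shows "\<exists>(f :: nat \<Rightarrow> (nat \<Rightarrow> bool) \<Rightarrow> bool) (g :: nat \<Rightarrow> (nat \<Rightarrow> bool) \<Rightarrow> bool).
     (\<forall>n\<ge>1. depends_only (f n) {0..<n} \<and> depends_only (g n) {0..n}
            \<and> f n = forget n (g n))
   \<and> (\<exists>c::real>0. \<exists>N. \<forall>n\<ge>N. \<forall>C. is_dDNNF C \<and> eval C = f n \<longrightarrow>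
            2 powr (c * real n) \<le> real (size_nnf C))
   \<and> (\<exists>(k::nat) (a::real). \<forall>n\<ge>1. \<exists>C. is_dDNNF C \<and> eval C = g n \<and>
            real (size_nnf C) \<le> a * real n ^ k)"
proof -
  obtain \<rho> a b where perm: "\<And>k. \<rho> k permutes {..<k}"
    and hard: "\<And>k C. 100 \<le> k \<Longrightarrow> is_dDNNF C \<Longrightarrow> eval C = two_path_function k (\<rho> k) (a k) (b k) \<Longrightarrow>
      2 powr (real k / 6400) \<le> 8 * (real (size_nnf C))\<^sup>2"
    using hard_two_path_function by metis
  \<comment> \<open>The paths use at most the variables below \<open>n\<close>, for odd
    \<open>n\<close> all but the last of them; the variable \<open>n\<close> serves as
    \<open>Z\<close>.\<close>
  define p where "p n = two_paths.path0 (n div 2)" for n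
  define q where "q n = two_paths.path1 (n div 2) (\<rho> (n div 2))" for n
  define f where "f n = two_path_function (n div 2) (\<rho> (n div 2)) (a (n div 2)) (b (n div 2))" for n
  define g where "g n \<sigma> \<longleftrightarrow> (if \<sigma> n then path_parity (p n) False \<sigma> = a (n div 2)
    else path_parity (q n) False \<sigma> = b (n div 2))" for n \<sigma>
  have tp: "two_paths (n div 2) (\<rho> (n div 2))" for n by unfold_locales (rule perm)
  have sub: "set (p n) \<subseteq> {0..<n}" "set (q n) \<subseteq> {0..<n}" for n
    using two_paths.set_paths[OF tp[of n]] unfolding p_def q_def by force+
  have f_def': "f n \<sigma> \<longleftrightarrow> path_parity (p n) False \<sigma> = a (n div 2) \<or> path_parity (q n) False \<sigma> = b (n div 2)" for n \<sigma>
    unfolding f_def two_path_function_def p_def q_def ..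
  have cong: "path_parity (p n) False \<sigma> = path_parity (p n) False \<tau>"
    "path_parity (q n) False \<sigma> = path_parity (q n) False \<tau>" if "\<forall>v\<in>{0..<n}. \<sigma> v = \<tau> v" for n \<sigma> \<tau>
    by (rule path_parity_cong; use that sub[of n] in blast)+
  have "depends_only (f n) {0..<n}" for n
    unfolding depends_only_def
  proof (intro allI impI)
    fix \<sigma> \<tau> :: "nat \<Rightarrow> bool" assume *: "\<forall>v\<in>{0..<n}. \<sigma> v = \<tau> v"
    show "f n \<sigma> = f n \<tau>" unfolding f_def' cong[OF *] ..
  qed
  moreover have "depends_only (g n) {0..n}" for n
    unfolding depends_only_def
  proof (intro allI impI)
    fix \<sigma> \<tau> :: "nat \<Rightarrow> bool" assume *: "\<forall>v\<in>{0..n}. \<sigma> v = \<tau> v"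
    then have "\<forall>v\<in>{0..<n}. \<sigma> v = \<tau> v" "\<sigma> n = \<tau> n" by auto
    then show "g n \<sigma> = g n \<tau>" unfolding g_def using cong[of n \<sigma> \<tau>] by simp
  qed
  moreover have "f n = forget n (g n)" for n
  proof
    fix \<sigma> :: "nat \<Rightarrow> bool"
    have "path_parity (p n) False (\<sigma>(n := True)) = path_parity (p n) False \<sigma>"
      "path_parity (q n) False (\<sigma>(n := False)) = path_parity (q n) False \<sigma>"
      by (rule cong; simp)+
    then show "f n \<sigma> = forget n (g n) \<sigma>" unfolding f_def' forget_def g_def by simp
  qed
  moreover have "2 powr (1 / 30000 * real n) \<le> real (size_nnf C)"
    if n: "n \<ge> 300000" and C: "is_dDNNF C" "eval C = f n" for n C
  proof -
    have "2 powr (real (n div 2) / 6400) \<le> 8 * (real (size_nnf C))\<^sup>2"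
      using hard[of "n div 2" C] n C unfolding f_def by simp
    \<comment> \<open>The 3 pays for the factor 8, and the square root later turns 15000 into 30000.
      The slack between 1/12800 and 1/15000 covers the 3 and the rounding of \<open>n div 2\<close>
      once \<open>n\<close> is at least 300000.\<close>
    moreover have "real n / 15000 + 3 \<le> real (n div 2) / 6400"
    proof -
      have "real n - 1 \<le> 2 * real (n div 2)" by linarith
      then show ?thesis using n by (simp add: field_simps)
    qed
    then have "2 powr (real n / 15000 + 3) \<le> 2 powr (real (n div 2) / 6400)" by simp
    moreover have "2 powr (real n / 15000 + 3) = 8 * (2 powr (1 / 30000 * real n))\<^sup>2"
      by (simp add: powr_add power2_eq_square flip: powr_add[of _ "real n / 30000"])
    ultimately have "(2 powr (1 / 30000 * real n))\<^sup>2 \<le> (real (size_nnf C))\<^sup>2" by linarith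
    then show ?thesis by (rule power2_le_imp_le) simp
  qed
  moreover have "\<exists>C. is_dDNNF C \<and> eval C = g n \<and> real (size_nnf C) \<le> 100 * real n ^ 1" if n: "n \<ge> 1" for n
  proof -
    let ?A = "parity_circuit (p n) False (a (n div 2))" and ?B = "parity_circuit (q n) False (b (n div 2))"
    have "distinct (p n)" "distinct (q n)"
      unfolding p_def q_def by (rule two_paths.distinct_paths[OF tp])+
    moreover have "n \<notin> vars ?A" "n \<notin> vars ?B" using vars_parity_circuit sub by fastforce+
    ultimately have dd: "is_dDNNF (decide n ?A ?B)" by (intro is_dDNNF_decide is_dDNNF_parity_circuit)
    have ev: "eval (decide n ?A ?B) = g n"
      unfolding g_def eval_decide eval_parity_circuit fun_eq_iff by simp
    have "size_nnf (decide n ?A ?B) \<le> 30 * (2 * (n div 2) + n div 2) + 27"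
      using size_decide_parity_circuits[of n "p n" False "a (n div 2)" "q n" False "b (n div 2)"]
        two_paths.length_paths[OF tp[of n]] unfolding p_def q_def by simp
    also have "30 * (2 * (n div 2) + n div 2) + 27 \<le> 100 * n"
      using n div_times_less_eq_dividend[of n 2] by simp
    finally have "size_nnf (decide n ?A ?B) \<le> 100 * n" .
    then have "real (size_nnf (decide n ?A ?B)) \<le> real (100 * n)" by (rule of_nat_mono)
    then show ?thesis using dd ev by (intro exI[of _ "decide n ?A ?B"]) simp
  qed
  ultimately show ?thesis
    by (intro exI[of _ f] exI[of _ g] conjI exI[of _ "1 / 30000 :: real"] exI[of _ "300000 :: nat"]
        exI[of _ "1 :: nat"] exI[of _ "100 :: real"]) auto
qed

end
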